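(* Let $(B_t)_{0\le t\le1}$ be one-dimensional Brownian motion started at $0$, and let $\ell$ be the measure on $[0,1]$ whose distribution function is the Brownian local time at zero $(\ell(t):0\le t\le1)$. With probability one there exists a finite constant $C=C(\omega)$ (not depending on $f$) such that $$\mathcal E_f(\ell)\;\le\;C\int_0^1f(r)\,r^{-1/2}\,dr\qquad\text{for all kernels } f.$$
   Context: A kernel is a weakly decreasing function $f:[0,\infty)\to[0,\infty]$ such that $\lim_{r\downarrow0}f(r)=f(0)$ if this limit is finite. For a Borel measure $\nu$ on $\mathbf R$, the energy is $\mathcal E_f(\nu)=\int\int f(|x-y|)\,d\nu(x)\,d\nu(y)$. Brownian local time at zero $\ell(t)$ is normalized so that (by results of Lévy) $\ell(t)$ has the same law as the running maximum $\max_{\tau\le t}B_\tau$. The same letter $\ell$ denotes the measure, supported on the zero set $Z=\{t\in[0,1]:B_t=0\}$, with $\ell([0,t])=\ell(t)$. *)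

theory Defs
  imports "HOL-Probability.Probability"
begin

text \<open>Standard one-dimensional Brownian motion \<open>(B t)\<close>, \<open>0 \<le> t \<le> T\<close>, started at \<open>0\<close>.
  Values of \<open>B\<close> outside \<open>{0..T}\<close> are irrelevant.\<close>

locale brownian_motion = prob_space M for M :: "'a measure" +
  fixes T :: real and B :: "real \<Rightarrow> 'a \<Rightarrow> real"
  assumes random_variable_B: "\<And>t. t \<in> {0..T} \<Longrightarrow> random_variable borel (B t)"
    and start: "AE \<omega> in M. B 0 \<omega> = 0"
    and independent_increments:
      "\<And>(n::nat) u. mono_on {..n} u \<Longrightarrow> u ` {..n} \<subseteq> {0..T} \<Longrightarrow>
        indep_vars (\<lambda>_. borel) (\<lambda>i \<omega>. B (u (Suc i)) \<omega> - B (u i) \<omega>) {..<n}"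
    and normal_increments:
      "\<And>s t. 0 \<le> s \<Longrightarrow> s < t \<Longrightarrow> t \<le> T \<Longrightarrow>
        distributed M lborel (\<lambda>\<omega>. B t \<omega> - B s \<omega>) (normal_density 0 (sqrt (t - s)))"
    and continuous_paths: "AE \<omega> in M. continuous_on {0..T} (\<lambda>t. B t \<omega>)"

text \<open>\<open>L\<close> is (a continuous version of) the local time at zero of \<open>B\<close> on \<open>{0..T}\<close>, i.e.\ the
  occupation density at level \<open>0\<close>. The factor \<open>1 / (2 * \<epsilon>)\<close> is the normalization under which, by
  Levy's theorem, \<open>L t\<close> has the law of the running maximum of \<open>B\<close> up to time \<open>t\<close>.\<close>

definition local_time_at_zero ::
  "'a measure \<Rightarrow> real \<Rightarrow> (real \<Rightarrow> 'a \<Rightarrow> real) \<Rightarrow> (real \<Rightarrow> 'a \<Rightarrow> real) \<Rightarrow> bool" where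
  "local_time_at_zero M T B L \<longleftrightarrow>
    (\<forall>t\<in>{0..T}. L t \<in> borel_measurable M) \<and>
    (AE \<omega> in M. continuous_on {0..T} (\<lambda>t. L t \<omega>)) \<and>
    (AE \<omega> in M. \<forall>t\<in>{0..T}.
      ((\<lambda>\<epsilon>. measure lborel {s \<in> {0..t}. \<bar>B s \<omega>\<bar> \<le> \<epsilon>} / (2 * \<epsilon>)) \<longlongrightarrow> L t \<omega>) (at_right 0))"

text \<open>The Borel measure on the real line, carried by \<open>{0..T}\<close>, that gives \<open>{0..t}\<close> the mass \<open>F t\<close>
  for \<open>t \<in> {0..T}\<close>; meaningful for \<open>F\<close> continuous and nondecreasing on \<open>{0..T}\<close> with \<open>F 0 = 0\<close>,
  which holds for almost every path of the local time.\<close>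

definition distribution_measure :: "real \<Rightarrow> (real \<Rightarrow> real) \<Rightarrow> real measure" where
  "distribution_measure T F = interval_measure (\<lambda>t. F (max 0 (min t T)))"

text \<open>Kernels are functions on \<open>{0..}\<close>; values at negative reals are irrelevant. The limit at
  \<open>0\<close> always exists in \<open>[0, \<infinity>]\<close> by monotonicity.\<close>

definition energy_kernel :: "(real \<Rightarrow> ennreal) \<Rightarrow> bool" where
  "energy_kernel f \<longleftrightarrow> antimono_on {0..} f \<and>
    (\<forall>c. (f \<longlongrightarrow> c) (at_right 0) \<and> c < \<infinity> \<longrightarrow> c = f 0)"

definition energy :: "(real \<Rightarrow> ennreal) \<Rightarrow> real measure \<Rightarrow> ennreal" where
  "energy f \<nu> = (\<integral>\<^sup>+ y. (\<integral>\<^sup>+ x. f \<bar>x - y\<bar> \<partial>\<nu>) \<partial>\<nu>)"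

end

theory Submission imports Defs begin

text \<open>By splitting a kernel into shells it suffices to find \<open>C\<close> with
  \<open>(\<ell> \<times> \<ell>) {(x, y). \<bar>x - y\<bar> \<le> h} \<le> C * sqrt h\<close> for all \<open>h = 4\<^sup>-\<^sup>n\<close>. Approximate \<open>\<ell>\<close> by the occupation
  measures \<open>w (B s) ds\<close> with \<open>w = indicator {-\<epsilon>..\<epsilon>} / (2 * \<epsilon>)\<close>, so that the left-hand side becomes the integral
  of \<open>w (B u) * w (B v)\<close> over \<open>u < v \<le> u + h\<close>, up to a constant factor. Replacing \<open>w (B v)\<close> by its
  conditional expectation given \<open>B u\<close>, which is at most \<open>1 / sqrt (v - u)\<close>, leaves at most \<open>2 * sqrt h\<close>
  times the total occupation, and that stays bounded as \<open>\<epsilon> \<rightarrow> 0\<close>. The error of this replacement is a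
  double integral whose integrands at \<open>(u, v)\<close> and \<open>(u', v')\<close> are uncorrelated unless the intervals
  overlap, so its second moment is of order \<open>h powr (3 / 2)\<close>, uniformly in \<open>\<epsilon>\<close>. After division by \<open>h\<close> this
  is summable over \<open>h = 4\<^sup>-\<^sup>n\<close>, which gives the almost sure bound simultaneously for all \<open>n\<close>.\<close>

section \<open>Energy and adjacent intervals\<close>

text \<open>For a measure with distribution function \<open>G\<close> this sums, over the cells of
  length 1/N in (0, 1], the mass of a cell times the mass of that cell together with its two
  neighbours. It dominates the mass near the diagonal, yet it involves only finitely many values of
  \<open>G\<close> and hence passes to pointwise limits.\<close>

definition adjacent_sum :: "(real \<Rightarrow> real) \<Rightarrow> nat \<Rightarrow> real" where
  "adjacent_sum G N = (\<Sum>i<N. (G ((real i + 1) / N) - G (real i / N)) *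
     (G ((real i + 2) / N) - G ((real i - 1) / N)))"

lemma unit_Ioc_cover:
  assumes "0 < N" "y \<in> {0<..1::real}"
  obtains i :: nat where "i < N" "y \<in> {real i / N<..(real i + 1) / N}"
proof -
  \<comment> \<open>The cells are open on the left, hence ceiling minus one rather than
    floor.\<close>
  define i where "i = nat (\<lceil>y * N\<rceil> - 1)"
  have pos: "0 < y * N" using assms by simp
  hence c: "1 \<le> \<lceil>y * N\<rceil>" by linarith
  have ri: "real i = of_int \<lceil>y * N\<rceil> - 1" using c by (simp add: i_def)
  have "y * N \<le> N" using assms by (simp add: mult_left_le_one_le)
  hence "\<lceil>y * N\<rceil> \<le> int N" by (simp add: ceiling_le_iff)
  hence "i < N" using c unfolding i_def by linarith
  moreover have "real i < y * N" "y * N \<le> real i + 1" using ri by linarith+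
  ultimately show ?thesis using assms by (intro that[of i]) (auto simp: field_simps)
qed

section \<open>Energy of an atomless measure on (0, 1] from its mass near the diagonal\<close>

locale unit_distribution =
  fixes G :: "real \<Rightarrow> real"
  assumes mono_G: "\<And>x y. x \<le> y \<Longrightarrow> G x \<le> G y"
    and continuous_G: "continuous_on UNIV G"
    and G_left: "\<And>x. x \<le> 0 \<Longrightarrow> G x = G 0"
    and G_right: "\<And>x. 1 \<le> x \<Longrightarrow> G x = G 1"
begin

lemma right_continuous_G: "continuous (at_right a) G"
  using continuous_G
  by (simp add: continuous_on_eq_continuous_at continuous_at_imp_continuous_within)

lemma emeasure_Ioc: "a \<le> b \<Longrightarrow> emeasure (interval_measure G) {a<..b} = ennreal (G b - G a)"
  by (rule emeasure_interval_measure_Ioc) (auto intro: mono_G right_continuous_G)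

text \<open>Continuity of \<open>G\<close> excludes atoms. This makes the diagonal harmless when
  \<open>f 0\<close> is infinite.\<close>

lemma emeasure_singleton: "emeasure (interval_measure G) {a} = 0"
  using emeasure_interval_measure_Icc[of a a G] by (simp add: mono_G continuous_G)

lemma AE_unit: "AE x in interval_measure G. x \<in> {0<..1}"
proof (rule AE_I')
  have "{- real n<..0} \<in> null_sets (interval_measure G)" for n
    using emeasure_Ioc[of "- real n" 0] by (auto simp: null_sets_def G_left[of "- real n"])
  moreover have "{1<..1 + real n} \<in> null_sets (interval_measure G)" for n
    using emeasure_Ioc[of 1 "1 + real n"] by (auto simp: null_sets_def G_right[of "1 + real n"])
  ultimately show "(\<Union>n. {- real n<..0}) \<union> (\<Union>n. {1<..1 + real n}) \<in> null_sets (interval_measure G)"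
    by (intro null_sets.Un null_sets_UN') auto
  have "\<exists>n. - real n < x" for x by (metis neg_less_iff_less minus_minus reals_Archimedean2)
  moreover have "\<exists>n. x \<le> 1 + real n" for x
    using real_arch_simple[of "x - 1"] by (auto simp: algebra_simps)
  ultimately show "{x \<in> space (interval_measure G). x \<notin> {0<..1}} \<subseteq> (\<Union>n. {- real n<..0}) \<union> (\<Union>n. {1<..1 + real n})"
    by (auto simp: not_less not_le)
qed

sublocale sigma_finite_measure "interval_measure G"
  by (rule sigma_finite_interval_measure) (auto intro: mono_G right_continuous_G)

lemma measurable_near_mass [measurable]:
  "(\<lambda>y. emeasure (interval_measure G) {x. \<bar>x - y\<bar> \<le> h}) \<in> borel_measurable borel"
proof -
  have "(\<lambda>y. \<integral>\<^sup>+x. indicator {x. \<bar>x - y\<bar> \<le> h} x \<partial>interval_measure G) \<in> borel_measurable borel"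
    unfolding indicator_def mem_Collect_eq by measurable
  then show ?thesis by simp
qed

text \<open>If \<open>y\<close> lies in a cell, every point within 1/N of \<open>y\<close> lies in
  that cell or in one of its neighbours.\<close>

lemma pair_mass_le_adjacent_sum:
  assumes N: "0 < N"
  shows "(\<integral>\<^sup>+y. emeasure (interval_measure G) {x. \<bar>x - y\<bar> \<le> 1 / N} \<partial>interval_measure G)
    \<le> ennreal (adjacent_sum G N)"
proof -
  let ?\<nu> = "interval_measure G"
  let ?I = "\<lambda>i::nat. {real i / N<..(real i + 1) / N}"
  let ?J = "\<lambda>i::nat. {(real i - 1) / N<..(real i + 2) / N}"
  have "(\<integral>\<^sup>+y. emeasure ?\<nu> {x. \<bar>x - y\<bar> \<le> 1 / N} \<partial>?\<nu>)
      \<le> (\<integral>\<^sup>+y. (\<Sum>i<N. emeasure ?\<nu> (?J i) * indicator (?I i) y) \<partial>?\<nu>)"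
  proof (rule nn_integral_mono_AE, use AE_unit in eventually_elim)
    fix y assume "y \<in> {0<..1::real}"
    then obtain i where i: "i < N" "y \<in> ?I i" using unit_Ioc_cover[OF N] by blast
    have "emeasure ?\<nu> {x. \<bar>x - y\<bar> \<le> 1 / N} \<le> emeasure ?\<nu> (?J i)"
      using i N by (intro emeasure_mono) (auto simp: abs_le_iff field_simps)
    also have "\<dots> = emeasure ?\<nu> (?J i) * indicator (?I i) y" using i by simp
    also have "\<dots> \<le> (\<Sum>i<N. emeasure ?\<nu> (?J i) * indicator (?I i) y)"
      using i by (intro member_le_sum) auto
    finally show "emeasure ?\<nu> {x. \<bar>x - y\<bar> \<le> 1 / N} \<le> (\<Sum>i<N. emeasure ?\<nu> (?J i) * indicator (?I i) y)" .
  qed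
  also have "\<dots> = (\<Sum>i<N. emeasure ?\<nu> (?J i) * emeasure ?\<nu> (?I i))"
    by (subst nn_integral_sum) (auto simp: nn_integral_cmult)
  also have "\<dots> = (\<Sum>i<N. ennreal ((G ((real i + 1) / N) - G (real i / N)) *
      (G ((real i + 2) / N) - G ((real i - 1) / N))))"
    using N by (intro sum.cong refl)
      (auto simp: emeasure_Ioc divide_right_mono ennreal_mult' mono_G mult.commute
        intro!: arg_cong2[where f="(*)"])
  also have "\<dots> = ennreal (adjacent_sum G N)"
    unfolding adjacent_sum_def using N
    by (intro sum_ennreal mult_nonneg_nonneg) (auto intro!: mono_G simp: divide_right_mono)
  finally show ?thesis .
qed

text \<open>A distance \<open>d\<close> with (1/4)^(n+1) < d <= (1/4)^n has \<open>f d\<close> at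
  most \<open>f ((1/4) ^ Suc n)\<close>, and the mass of such pairs is at most the adjacent sum of
  mesh (1/4)^n. Base 4 turns the order sqrt h of that mass into 2^-n.\<close>

lemma energy_le_dyadic_sum:
  fixes f :: "real \<Rightarrow> ennreal"
  assumes f: "antimono_on {0..} f"
    and C: "\<And>n. adjacent_sum G (4 ^ n) \<le> C / 2 ^ n"
  shows "energy f (interval_measure G) \<le> (\<Sum>n. f ((1/4) ^ Suc n) * ennreal (C / 2 ^ n))"
proof -
  let ?\<nu> = "interval_measure G"
  let ?D = "\<lambda>n y. {x. \<bar>x - y\<bar> \<le> (1/4::real) ^ n}"
  have *: "(\<integral>\<^sup>+x. f \<bar>x - y\<bar> \<partial>?\<nu>) \<le> (\<Sum>n. f ((1/4) ^ Suc n) * emeasure ?\<nu> (?D n y))"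
    if y: "y \<in> {0<..1}" for y
  proof -
    have "(\<integral>\<^sup>+x. f \<bar>x - y\<bar> \<partial>?\<nu>)
        \<le> (\<integral>\<^sup>+x. top * indicator {y} x + (\<Sum>n. f ((1/4) ^ Suc n) * indicator (?D n y) x) \<partial>?\<nu>)"
    proof (rule nn_integral_mono_AE, use AE_unit in eventually_elim)
      fix x assume x: "x \<in> {0<..1::real}"
      show "f \<bar>x - y\<bar> \<le> top * indicator {y} x + (\<Sum>n. f ((1/4) ^ Suc n) * indicator (?D n y) x)"
      \<comment> \<open>For \<open>x = y\<close> the summand \<open>top * indicator {y} x\<close>
        majorizes the possibly infinite \<open>f 0\<close>; its integral vanishes because singletons
        are null.\<close>
      proof (cases "x = y")
        case False
        define d where "d = \<bar>x - y\<bar>"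
        have d: "0 < d" "d \<le> 1" using False x y by (auto simp: d_def)
        have "\<exists>n. (1/4::real) ^ n < d" using d by (intro real_arch_pow_inv) auto
        \<comment> \<open>The first power below \<open>d\<close>. It has a predecessor because
          \<open>d \<le> 1\<close> rules out the exponent 0.\<close>
        define m where "m = (LEAST n. (1/4::real) ^ n < d)"
        have m: "(1/4) ^ m < d" unfolding m_def by (rule LeastI_ex) fact
        have "m \<noteq> 0" using m d by (intro notI) simp
        then obtain n where n: "m = Suc n" by (cases m) auto
        have "\<not> (1/4) ^ n < d" using n unfolding m_def by (metis lessI not_less_Least)
        hence "x \<in> ?D n y" by (simp add: d_def)
        have "f d \<le> f ((1/4) ^ Suc n)"
          using m n d by (intro monotone_onD[OF f]) auto
        also have "\<dots> = f ((1/4) ^ Suc n) * indicator (?D n y) x" using \<open>x \<in> ?D n y\<close> by simp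
        also have "\<dots> \<le> (\<Sum>n. f ((1/4) ^ Suc n) * indicator (?D n y) x)"
          using sum_le_suminf[OF summableI, of "{n}" "\<lambda>n. f ((1/4) ^ Suc n) * indicator (?D n y) x"]
          by (simp del: sum_mult_indicator power_Suc)
        also have "\<dots> \<le> top * indicator {y} x + (\<Sum>n. f ((1/4) ^ Suc n) * indicator (?D n y) x)"
          by simp
        finally show ?thesis by (simp add: d_def)
      qed simp
    qed
    also have "\<dots> = (\<Sum>n. f ((1/4) ^ Suc n) * emeasure ?\<nu> (?D n y))"
      by (subst nn_integral_add)
         (auto simp: nn_integral_suminf nn_integral_cmult emeasure_singleton nn_integral_cmult_indicator)
    finally show ?thesis .
  qed
  have "energy f ?\<nu> \<le> (\<integral>\<^sup>+y. (\<Sum>n. f ((1/4) ^ Suc n) * emeasure ?\<nu> (?D n y)) \<partial>?\<nu>)"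
    unfolding energy_def
    by (rule nn_integral_mono_AE, use AE_unit in eventually_elim) (rule *)
  also have "\<dots> = (\<Sum>n. f ((1/4) ^ Suc n) * (\<integral>\<^sup>+y. emeasure ?\<nu> (?D n y) \<partial>?\<nu>))"
    by (subst nn_integral_suminf) (auto simp: nn_integral_cmult)
  also have "\<dots> \<le> (\<Sum>n. f ((1/4) ^ Suc n) * ennreal (C / 2 ^ n))"
  proof (intro suminf_le mult_left_mono summableI)
    fix n
    have "(\<integral>\<^sup>+y. emeasure ?\<nu> (?D n y) \<partial>?\<nu>) \<le> ennreal (adjacent_sum G (4 ^ n))"
      using pair_mass_le_adjacent_sum[of "4 ^ n"] by (simp add: power_one_over)
    also have "\<dots> \<le> ennreal (C / 2 ^ n)" using C by (rule ennreal_leI)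
    finally show "(\<integral>\<^sup>+y. emeasure ?\<nu> (?D n y) \<partial>?\<nu>) \<le> ennreal (C / 2 ^ n)" .
  qed simp
  finally show ?thesis .
qed

end

text \<open>Each term is spread over a shell one scale further in, between (1/4)^(n+2) and
  (1/4)^(n+1). There \<open>f r\<close> is at least \<open>f ((1/4) ^ Suc n)\<close> and r^(-1/2) is
  at least 2^(n+1). The shells are disjoint and lie in [0, 1].\<close>

lemma dyadic_sum_le_integral:
  fixes f :: "real \<Rightarrow> ennreal"
  assumes f: "antimono_on {0..} f" and C: "0 \<le> C"
  shows "(\<Sum>n. f ((1/4) ^ Suc n) * ennreal (C / 2 ^ n))
    \<le> ennreal (8 / 3 * C) * (\<integral>\<^sup>+ r\<in>{0..1}. f r * ennreal (r powr (- 1 / 2)) \<partial>lborel)"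
proof -
  define A where "A n = {(1/4::real) ^ Suc (Suc n)<..(1/4) ^ Suc n}" for n
  have "A m \<inter> A n = {}" if "m < n" for m n
  proof -
    have "(1/4::real) ^ Suc n \<le> (1/4) ^ Suc (Suc m)" using that by (intro power_decreasing) auto
    thus ?thesis by (auto simp: A_def)
  qed
  hence disj: "disjoint_family A" unfolding disjoint_family_on_def
    by (metis Int_commute linorder_neqE_nat)
  have sq: "((1/4::real) ^ k) powr (- 1 / 2) = 2 ^ k" for k
  proof -
    have "((1/4::real) ^ k) = ((1/2) ^ k)^2" by (simp add: power2_eq_square flip: power_mult_distrib)
    hence "((1/4::real) ^ k) powr (- 1 / 2) = inverse (sqrt (((1/2) ^ k)^2))"
      by (simp add: powr_minus powr_half_sqrt)
    also have "\<dots> = 2 ^ k" by (subst real_sqrt_unique[of "(1/2) ^ k"]) (auto simp: power_one_over field_simps)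
    finally show ?thesis .
  qed
  \<comment> \<open>The shell has length 3/16 * 4^-n, and 2^(n+1) times this is 3/8 * 2^-n, whence
    the factor 8/3.\<close>
  have shell: "f ((1/4) ^ Suc n) * ennreal (C / 2 ^ n) =
     ennreal (8 / 3 * C) * (\<integral>\<^sup>+r. f ((1/4) ^ Suc n) * ennreal (2 ^ Suc n) * indicator (A n) r \<partial>lborel)" for n
  proof -
    have "emeasure lborel (A n) = ennreal ((1/4) ^ Suc n - (1/4) ^ Suc (Suc n))"
      unfolding A_def by (rule emeasure_lborel_Ioc) simp
    hence e: "(\<integral>\<^sup>+r. f ((1/4) ^ Suc n) * ennreal (2 ^ Suc n) * indicator (A n) r \<partial>lborel)
       = f ((1/4) ^ Suc n) * ennreal (2 ^ Suc n) * ennreal (3/16 * (1/4) ^ n)"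
      by (subst nn_integral_cmult_indicator) (auto simp: A_def)
    have "ennreal (8 / 3 * C) * (ennreal (2 ^ Suc n) * ennreal (3/16 * (1/4) ^ n)) = ennreal (C / 2 ^ n)"
    proof -
      have "(4::real) ^ n = 2 ^ n * 2 ^ n" by (simp flip: power_mult_distrib)
      hence "8 / 3 * C * (2 ^ Suc n * (3/16 * (1/4) ^ n)) = C / 2 ^ n"
        by (simp add: power_one_over)
      thus ?thesis using C by (simp flip: ennreal_mult)
    qed
    thus ?thesis unfolding e by (metis mult.assoc mult.left_commute)
  qed
  have "(\<Sum>n. f ((1/4) ^ Suc n) * ennreal (C / 2 ^ n)) =
     ennreal (8 / 3 * C) * (\<integral>\<^sup>+r. (\<Sum>n. f ((1/4) ^ Suc n) * ennreal (2 ^ Suc n) * indicator (A n) r) \<partial>lborel)"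
    unfolding shell
    by (subst nn_integral_suminf) (auto simp: A_def)
  also have "\<dots> \<le> ennreal (8 / 3 * C) * (\<integral>\<^sup>+ r\<in>{0..1}. f r * ennreal (r powr (- 1 / 2)) \<partial>lborel)"
  proof (intro mult_left_mono nn_integral_mono)
    fix r :: real
    show "(\<Sum>n. f ((1/4) ^ Suc n) * ennreal (2 ^ Suc n) * indicator (A n) r)
      \<le> f r * ennreal (r powr (- 1 / 2)) * indicator {0..1} r"
    proof (cases "\<exists>n. r \<in> A n")
      case True
      then obtain n where n: "r \<in> A n" by blast
      have r: "0 < r" "r \<le> (1/4) ^ Suc n"
        using n by (auto simp: A_def elim!: order.strict_trans[rotated])
      have "(1/4::real) ^ Suc n \<le> 1" by (intro power_le_one) auto
      hence r1: "r \<le> 1" using r by linarith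
      have "(\<Sum>n. f ((1/4) ^ Suc n) * ennreal (2 ^ Suc n) * indicator (A n) r)
        = f ((1/4) ^ Suc n) * ennreal (2 ^ Suc n)"
        using suminf_cmult_indicator[OF disj n, of "\<lambda>n. f ((1/4) ^ Suc n) * ennreal (2 ^ Suc n)"] by simp
      also have "\<dots> \<le> f r * ennreal (r powr (- 1 / 2))"
      proof (intro mult_mono ennreal_leI)
        show "f ((1/4) ^ Suc n) \<le> f r" using r by (intro monotone_onD[OF f]) auto
        have "((1/4) ^ Suc n) powr (- 1 / 2) \<le> r powr (- 1 / 2)"
          using r by (intro powr_mono2') auto
        thus "2 ^ Suc n \<le> r powr (- 1 / 2)" by (simp only: sq)
      qed auto
      finally show ?thesis using r r1 by simp
    qed simp
  qed simp
  finally show ?thesis .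
qed

section \<open>The Markov property\<close>

text \<open>The last increment is independent of the first three jointly, so the joint law is a
  product. Integrating out the Gaussian increment first replaces \<open>f (B d)\<close> by its
  conditional expectation given \<open>B c\<close>.\<close>

lemma (in brownian_motion) markov_property:
  fixes \<Phi> :: "real \<times> real \<times> real \<Rightarrow> ennreal" and f :: "real \<Rightarrow> ennreal"
  assumes t: "0 \<le> a" "a \<le> b" "b \<le> c" "c < d" "d \<le> T"
    and [measurable]: "\<Phi> \<in> borel_measurable borel" "f \<in> borel_measurable borel"
  shows "(\<integral>\<^sup>+\<omega>. \<Phi> (B a \<omega>, B b \<omega>, B c \<omega>) * f (B d \<omega>) \<partial>M) =
    (\<integral>\<^sup>+\<omega>. \<Phi> (B a \<omega>, B b \<omega>, B c \<omega>) *
      (\<integral>\<^sup>+y. f (B c \<omega> + y) * ennreal (normal_density 0 (sqrt (d - c)) y) \<partial>lborel) \<partial>M)"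
proof -
  have [measurable]: "B a \<in> borel_measurable M" "B b \<in> borel_measurable M"
    "B c \<in> borel_measurable M" "B d \<in> borel_measurable M" "B 0 \<in> borel_measurable M"
    using t by (auto intro!: random_variable_B)
  \<comment> \<open>Past times may coincide, since the grid need only be monotone; the last step is
    proper, so that its increment has a density.\<close>
  define u :: "nat \<Rightarrow> real" where "u i = [0, a, b, c, d] ! i" for i
  define X where "X i \<omega> = B (u (Suc i)) \<omega> - B (u i) \<omega>" for i \<omega>
  have set4: "{..4::nat} = {0, 1, 2, 3, 4}" by auto
  have "mono_on {..4} u"
    unfolding set4 monotone_on_def u_def using t by auto
  moreover have "u ` {..4} \<subseteq> {0..T}" unfolding set4 u_def using t by auto
  ultimately have ind: "indep_vars (\<lambda>_. borel) X {..<4}"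
    unfolding X_def by (rule independent_increments)
  define Y where "Y \<omega> = (\<lambda>i\<in>{0, Suc 0, 2}. X i \<omega>)" for \<omega>
  define W where "W \<omega> = X 3 \<omega>" for \<omega>
  let ?S = "PiM {0, Suc 0, 2} (\<lambda>_. borel) :: (nat \<Rightarrow> real) measure"
  let ?T = "PiM {3} (\<lambda>_. borel) :: (nat \<Rightarrow> real) measure"
  \<comment> \<open>Independence of blocks is stated for families, hence the last increment is
    wrapped as a function on the index set {3}.\<close>
  define V where "V \<omega> = (\<lambda>i\<in>{3::nat}. X i \<omega>)" for \<omega>
  have "indep_var ?S Y ?T V"
    unfolding Y_def V_def by (rule indep_var_restrict[OF ind]) auto
  hence [measurable]: "Y \<in> measurable M ?S" "V \<in> measurable M ?T"
    and joint: "distr M (?S \<Otimes>\<^sub>M ?T) (\<lambda>\<omega>. (Y \<omega>, V \<omega>)) = distr M ?S Y \<Otimes>\<^sub>M distr M ?T V"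
    unfolding indep_var_distribution_eq by auto
  have V_3: "V \<omega> 3 = W \<omega>" for \<omega> by (simp add: V_def W_def)
  have W_eq: "W = (\<lambda>\<omega>. B d \<omega> - B c \<omega>)" by (auto simp: W_def X_def u_def numeral_eq_Suc)
  have W: "distributed M lborel W (normal_density 0 (sqrt (d - c)))"
    unfolding W_eq using t by (intro normal_increments) auto
  define \<Psi> where "\<Psi> = (\<lambda>(x, v :: nat \<Rightarrow> real). \<Phi> (x 0, x 0 + x 1, x 0 + x (1::nat) + x 2) * f (x 0 + x 1 + x 2 + v 3))"
  have [measurable]: "\<Psi> \<in> borel_measurable (?S \<Otimes>\<^sub>M ?T)"
    unfolding \<Psi>_def borel_prod[symmetric] by measurable
  interpret PW: prob_space "distr M ?T V" by (rule prob_space_distr) simp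
  \<comment> \<open>Almost surely only: the first increment is \<open>B a - B 0\<close>, and
    \<open>B 0\<close> vanishes up to a null set.\<close>
  have AE_Y: "AE \<omega> in M. Y \<omega> 0 = B a \<omega> \<and> Y \<omega> (Suc 0) = B b \<omega> - B a \<omega> \<and> Y \<omega> 2 = B c \<omega> - B b \<omega>"
    using start by eventually_elim (simp add: Y_def X_def u_def numeral_eq_Suc)
  have "(\<integral>\<^sup>+\<omega>. \<Phi> (B a \<omega>, B b \<omega>, B c \<omega>) * f (B d \<omega>) \<partial>M) = (\<integral>\<^sup>+\<omega>. \<Psi> (Y \<omega>, V \<omega>) \<partial>M)"
    by (rule nn_integral_cong_AE, use AE_Y in eventually_elim) (simp add: \<Psi>_def V_3 W_eq)
  also have "\<dots> = (\<integral>\<^sup>+z. \<Psi> z \<partial>distr M (?S \<Otimes>\<^sub>M ?T) (\<lambda>\<omega>. (Y \<omega>, V \<omega>)))"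
    by (subst nn_integral_distr) auto
  also have "\<dots> = (\<integral>\<^sup>+x. \<integral>\<^sup>+y. \<Psi> (x, y) \<partial>distr M ?T V \<partial>distr M ?S Y)"
    unfolding joint by (subst PW.nn_integral_fst[symmetric]) auto
  also have "\<dots> = (\<integral>\<^sup>+\<omega>. \<integral>\<^sup>+y. \<Psi> (Y \<omega>, y) \<partial>distr M ?T V \<partial>M)"
    by (subst nn_integral_distr) auto
  also have "\<dots> = (\<integral>\<^sup>+\<omega>. \<Phi> (B a \<omega>, B b \<omega>, B c \<omega>) *
      (\<integral>\<^sup>+y. f (B c \<omega> + y) * ennreal (normal_density 0 (sqrt (d - c)) y) \<partial>lborel) \<partial>M)"
  proof (rule nn_integral_cong_AE, use AE_Y in eventually_elim)
    fix \<omega>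
    assume Y: "Y \<omega> 0 = B a \<omega> \<and> Y \<omega> (Suc 0) = B b \<omega> - B a \<omega> \<and> Y \<omega> 2 = B c \<omega> - B b \<omega>"
    have "(\<integral>\<^sup>+y. \<Psi> (Y \<omega>, y) \<partial>distr M ?T V)
      = (\<integral>\<^sup>+v. \<Phi> (B a \<omega>, B b \<omega>, B c \<omega>) * f (B c \<omega> + v 3) \<partial>distr M ?T V)"
      using Y by (simp add: \<Psi>_def)
    also have "\<dots> = \<Phi> (B a \<omega>, B b \<omega>, B c \<omega>) * (\<integral>\<^sup>+v. f (B c \<omega> + v 3) \<partial>distr M ?T V)"
      by (rule nn_integral_cmult) measurable
    also have "(\<integral>\<^sup>+v. f (B c \<omega> + v 3) \<partial>distr M ?T V) = (\<integral>\<^sup>+\<omega>'. f (B c \<omega> + W \<omega>') \<partial>M)"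
      by (subst nn_integral_distr) (auto simp: V_3)
    also have "\<dots> = (\<integral>\<^sup>+y. ennreal (normal_density 0 (sqrt (d - c)) y) * f (B c \<omega> + y) \<partial>lborel)"
      by (rule distributed_nn_integral[OF W, symmetric]) simp
    finally show "(\<integral>\<^sup>+y. \<Psi> (Y \<omega>, y) \<partial>distr M ?T V) = \<Phi> (B a \<omega>, B b \<omega>, B c \<omega>) *
      (\<integral>\<^sup>+y. f (B c \<omega> + y) * ennreal (normal_density 0 (sqrt (d - c)) y) \<partial>lborel)"
      by (simp add: mult.commute)
  qed
  finally show ?thesis .
qed

text \<open>Three past times suffice: for the second moment of a double integral over pairs of times, only
  four times occur together.\<close>

locale continuous_markov_motion = prob_space M for M :: "'a measure" +
  fixes B :: "real \<Rightarrow> 'a \<Rightarrow> real"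
  assumes continuous_B: "\<And>\<omega>. continuous_on UNIV (\<lambda>t. B t \<omega>)"
    and random_variable_B: "\<And>t. random_variable borel (B t)"
    and markov_property: "\<And>a b c d (\<Phi> :: real \<times> real \<times> real \<Rightarrow> ennreal) (f :: real \<Rightarrow> ennreal).
      0 \<le> a \<Longrightarrow> a \<le> b \<Longrightarrow> b \<le> c \<Longrightarrow> c < d \<Longrightarrow> d \<le> 1 \<Longrightarrow>
      \<Phi> \<in> borel_measurable borel \<Longrightarrow> f \<in> borel_measurable borel \<Longrightarrow>
      (\<integral>\<^sup>+\<omega>. \<Phi> (B a \<omega>, B b \<omega>, B c \<omega>) * f (B d \<omega>) \<partial>M) =
      (\<integral>\<^sup>+\<omega>. \<Phi> (B a \<omega>, B b \<omega>, B c \<omega>) *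
        (\<integral>\<^sup>+y. f (B c \<omega> + y) * ennreal (normal_density 0 (sqrt (d - c)) y) \<partial>lborel) \<partial>M)"

text \<open>Clamping the time to [0, 1] and changing paths on a null set makes every path continuous
  on the whole line, from which joint measurability will follow. The two processes agree almost
  surely on [0, 1], so the Markov property carries over.\<close>

lemma brownian_motion_continuous_version:
  fixes M :: "'a measure" and B :: "real \<Rightarrow> 'a \<Rightarrow> real"
  assumes "brownian_motion M 1 B"
  obtains B' where "continuous_markov_motion M B'" "AE \<omega> in M. \<forall>t\<in>{0..1}. B' t \<omega> = B t \<omega>"
proof -
  interpret brownian_motion M 1 B by fact
  obtain N where N: "N \<in> null_sets M"
    "{\<omega> \<in> space M. \<not> continuous_on {0..1} (\<lambda>t. B t \<omega>)} \<subseteq> N"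
    using continuous_paths by (auto simp: eventually_ae_filter)
  have [measurable]: "N \<in> sets M" using N(1) by auto
  \<comment> \<open>The zero path also covers \<open>\<omega>\<close> outside
    \<open>space M\<close>, because \<open>continuous_B\<close> ranges over all
    \<open>\<omega>\<close>.\<close>
  define B' where "B' t \<omega> = (if \<omega> \<in> space M - N then B (max 0 (min t 1)) \<omega> else 0)" for t \<omega>
  have AE_N: "AE \<omega> in M. \<omega> \<in> space M - N" using AE_not_in[OF N(1)] by auto
  have eq: "AE \<omega> in M. \<forall>t\<in>{0..1}. B' t \<omega> = B t \<omega>"
    using AE_N by eventually_elim (auto simp: B'_def)
  have "continuous_markov_motion M B'"
  proof
    fix \<omega>
    show "continuous_on UNIV (\<lambda>t. B' t \<omega>)"
    proof (cases "\<omega> \<in> space M - N")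
      case True
      hence "continuous_on {0..1} (\<lambda>t. B t \<omega>)" using N by blast
      hence "continuous_on UNIV (\<lambda>t. B (max 0 (min t 1)) \<omega>)"
        by (rule continuous_on_compose2) (auto intro!: continuous_intros)
      thus ?thesis using True by (simp add: B'_def)
    qed (auto simp: B'_def)
  next
    fix t
    have [measurable]: "B (max 0 (min t 1)) \<in> borel_measurable M"
      by (rule random_variable_B) auto
    show "random_variable borel (B' t)" unfolding B'_def by measurable
  next
    fix a b c d :: real and \<Phi> :: "real \<times> real \<times> real \<Rightarrow> ennreal" and f :: "real \<Rightarrow> ennreal"
    assume *: "0 \<le> a" "a \<le> b" "b \<le> c" "c < d" "d \<le> 1"
      "\<Phi> \<in> borel_measurable borel" "f \<in> borel_measurable borel"
    have eq': "AE \<omega> in M. B' a \<omega> = B a \<omega> \<and> B' b \<omega> = B b \<omega> \<and> B' c \<omega> = B c \<omega> \<and> B' d \<omega> = B d \<omega>"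
      using eq by eventually_elim (use * in auto)
    have "(\<integral>\<^sup>+\<omega>. \<Phi> (B' a \<omega>, B' b \<omega>, B' c \<omega>) * f (B' d \<omega>) \<partial>M) =
        (\<integral>\<^sup>+\<omega>. \<Phi> (B a \<omega>, B b \<omega>, B c \<omega>) * f (B d \<omega>) \<partial>M)"
      by (rule nn_integral_cong_AE, use eq' in eventually_elim) auto
    also note markov_property[OF *]
    also have "(\<integral>\<^sup>+\<omega>. \<Phi> (B a \<omega>, B b \<omega>, B c \<omega>) *
        (\<integral>\<^sup>+y. f (B c \<omega> + y) * ennreal (normal_density 0 (sqrt (d - c)) y) \<partial>lborel) \<partial>M) =
      (\<integral>\<^sup>+\<omega>. \<Phi> (B' a \<omega>, B' b \<omega>, B' c \<omega>) *
        (\<integral>\<^sup>+y. f (B' c \<omega> + y) * ennreal (normal_density 0 (sqrt (d - c)) y) \<partial>lborel) \<partial>M)"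
      by (rule nn_integral_cong_AE, use eq' in eventually_elim) auto
    finally show "(\<integral>\<^sup>+\<omega>. \<Phi> (B' a \<omega>, B' b \<omega>, B' c \<omega>) * f (B' d \<omega>) \<partial>M) =
      (\<integral>\<^sup>+\<omega>. \<Phi> (B' a \<omega>, B' b \<omega>, B' c \<omega>) *
        (\<integral>\<^sup>+y. f (B' c \<omega> + y) * ennreal (normal_density 0 (sqrt (d - c)) y) \<partial>lborel) \<partial>M)" .
  qed
  thus ?thesis using eq that by blast
qed

context continuous_markov_motion
begin

text \<open>Rounding the time down to multiples of 1/(n+1) leaves countably many random variables,
  hence a jointly measurable map. Path continuity gives pointwise convergence.\<close>

lemma measurable_B_pair: "(\<lambda>(t, \<omega>). B t \<omega>) \<in> borel_measurable (borel \<Otimes>\<^sub>M M)"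
proof (rule borel_measurable_LIMSEQ_real)
  define D where "D n z = B (real_of_int \<lfloor>fst z * real (Suc n)\<rfloor> / real (Suc n)) (snd z)" for n z
  show "D n \<in> borel_measurable (borel \<Otimes>\<^sub>M M)" for n
  proof -
    have [measurable]: "B t \<in> borel_measurable M" for t by (rule random_variable_B)
    have [measurable]: "(\<lambda>z. \<lfloor>fst z * real (Suc n)\<rfloor>) \<in> measurable (borel \<Otimes>\<^sub>M M) (count_space UNIV)"
      by measurable
    have "(\<lambda>z. (\<lambda>k z. B (real_of_int k / real (Suc n)) (snd z)) \<lfloor>fst z * real (Suc n)\<rfloor> z)
      \<in> borel_measurable (borel \<Otimes>\<^sub>M M)"
      by (rule measurable_compose_countable) measurable
    thus ?thesis by (simp add: D_def[abs_def])
  qed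
  fix z :: "real \<times> 'a"
  obtain t \<omega> where z: "z = (t, \<omega>)" by (cases z)
  have "(\<lambda>n. real_of_int \<lfloor>t * real (Suc n)\<rfloor> / real (Suc n)) \<longlonglongrightarrow> t"
  proof (rule tendsto_sandwich)
    show "\<forall>\<^sub>F n in sequentially. t - 1 / real (Suc n) \<le> real_of_int \<lfloor>t * real (Suc n)\<rfloor> / real (Suc n)"
    proof (intro always_eventually allI)
      fix n
      have "t * real (Suc n) - 1 \<le> real_of_int \<lfloor>t * real (Suc n)\<rfloor>" by linarith
      hence "(t * real (Suc n) - 1) / real (Suc n) \<le> real_of_int \<lfloor>t * real (Suc n)\<rfloor> / real (Suc n)"
        by (rule divide_right_mono) simp
      thus "t - 1 / real (Suc n) \<le> real_of_int \<lfloor>t * real (Suc n)\<rfloor> / real (Suc n)"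
        by (simp add: diff_divide_distrib del: of_nat_Suc)
    qed
    show "\<forall>\<^sub>F n in sequentially. real_of_int \<lfloor>t * real (Suc n)\<rfloor> / real (Suc n) \<le> t"
      by (intro always_eventually allI) (simp add: field_simps del: of_nat_Suc)
    show "(\<lambda>n. t - 1 / real (Suc n)) \<longlonglongrightarrow> t"
      using tendsto_diff[OF tendsto_const LIMSEQ_inverse_real_of_nat, of t] by (simp add: inverse_eq_divide)
  qed simp
  moreover have "isCont (\<lambda>t. B t \<omega>) t"
    using continuous_B by (simp add: continuous_on_eq_continuous_at)
  ultimately show "(\<lambda>n. D n z) \<longlonglongrightarrow> (case z of (t, \<omega>) \<Rightarrow> B t \<omega>)"
    unfolding z D_def by (simp add: isCont_tendsto_compose[of t "\<lambda>t. B t \<omega>"] del: of_nat_Suc)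
qed

lemma measurable_B [measurable (raw)]:
  assumes [measurable]: "t \<in> borel_measurable N" "\<omega> \<in> measurable N M"
  shows "(\<lambda>x. B (t x) (\<omega> x)) \<in> borel_measurable N"
  using measurable_compose[OF measurable_Pair[OF assms] measurable_B_pair] by simp

end

section \<open>Windows and the inverse square root\<close>

text \<open>For \<epsilon> > 0 this is the uniform density on [-\<epsilon>, \<epsilon>]. Integrating
  \<open>window \<epsilon> (B s)\<close> over [0, t] gives the quotient whose limit defines the
  local time.\<close>

definition window :: "real \<Rightarrow> real \<Rightarrow> real" where
  "window \<epsilon> x = indicator {- \<epsilon>..\<epsilon>} x / (2 * \<epsilon>)"

text \<open>With \<open>t = v - u\<close> and \<open>x = B u\<close>, this is the conditional
  expectation of \<open>window \<epsilon> (B v)\<close> given \<open>B u\<close>.\<close>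

definition window_mean :: "real \<Rightarrow> real \<Rightarrow> real \<Rightarrow> real" where
  "window_mean \<epsilon> t x = (\<integral>y. window \<epsilon> (x + y) * normal_density 0 (sqrt t) y \<partial>lborel)"

text \<open>The value at \<open>t \<le> 0\<close> is \<open>\<infinity>\<close>, so estimates by products of \<open>inv_sqrt\<close> hold trivially when two
  times coincide.\<close>

definition inv_sqrt :: "real \<Rightarrow> ennreal" where
  "inv_sqrt t = inverse (ennreal (sqrt t))"

text \<open>The cutoff allows integrals over short time gaps to be extended to the whole line, where
  they are translation invariant.\<close>

definition inv_sqrt_upto :: "real \<Rightarrow> real \<Rightarrow> ennreal" where
  "inv_sqrt_upto h t = inv_sqrt t * indicator {0..h} t"

lemma window_nonneg [simp]: "0 < \<epsilon> \<Longrightarrow> 0 \<le> window \<epsilon> x"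
  and window_le: "0 < \<epsilon> \<Longrightarrow> window \<epsilon> x \<le> 1 / (2 * \<epsilon>)"
  by (auto simp: window_def indicator_def)

lemma measurable_window [measurable]: "window \<epsilon> \<in> borel_measurable borel"
  unfolding window_def by measurable

lemma measurable_window_mean [measurable (raw)]:
  assumes [measurable]: "f \<in> borel_measurable N" "g \<in> borel_measurable N"
  shows "(\<lambda>z. window_mean \<epsilon> (f z) (g z)) \<in> borel_measurable N"
  unfolding window_mean_def normal_density_def by measurable

lemma nn_integral_window: "0 < \<epsilon> \<Longrightarrow> (\<integral>\<^sup>+y. ennreal (window \<epsilon> (x + y)) \<partial>lborel) = 1"
proof -
  assume e: "0 < \<epsilon>"
  have "(\<integral>\<^sup>+y. ennreal (window \<epsilon> (x + y)) \<partial>lborel)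
    = (\<integral>\<^sup>+y. ennreal (1 / (2 * \<epsilon>)) * indicator {- \<epsilon> - x..\<epsilon> - x} y \<partial>lborel)"
    by (rule nn_integral_cong) (auto simp: window_def indicator_def)
  also have "\<dots> = ennreal (1 / (2 * \<epsilon>)) * ennreal (2 * \<epsilon>)"
    using e by (subst nn_integral_cmult_indicator) auto
  also have "\<dots> = 1" using e by (simp flip: ennreal_mult)
  finally show ?thesis .
qed

lemma normal_density_le: "normal_density 0 (sqrt t) y \<le> 1 / sqrt t" if "0 < t"
proof -
  have "normal_density 0 (sqrt t) y \<le> 1 / sqrt (2 * pi * t)"
    using that by (simp add: normal_density_def divide_right_mono)
  also have "\<dots> \<le> 1 / sqrt t"
    using that pi_ge_two by (intro divide_left_mono real_sqrt_le_mono) (auto simp: mult_le_cancel_right1)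
  finally show ?thesis .
qed

context
  fixes \<epsilon> :: real assumes \<epsilon>: "0 < \<epsilon>"
begin

lemma integrable_window_normal:
  "0 < t \<Longrightarrow> integrable lborel (\<lambda>y. window \<epsilon> (x + y) * normal_density 0 (sqrt t) y)"
  by (rule Bochner_Integration.integrable_bound
      [where f = "\<lambda>y. 1 / (2 * \<epsilon>) * normal_density 0 (sqrt t) y"])
    (use \<epsilon> window_le[OF \<epsilon>] in \<open>auto simp: abs_mult simp del: times_divide_eq_left
      intro!: mult_right_mono AE_I2 integrable_mult_right integrable_normal_density\<close>)

lemma window_mean_nonneg [simp]: "0 \<le> window_mean \<epsilon> t x"
  unfolding window_mean_def using \<epsilon> by (intro integral_nonneg_AE AE_I2) auto

lemma nn_integral_window_normal:
  "0 < t \<Longrightarrow> (\<integral>\<^sup>+y. ennreal (window \<epsilon> (x + y)) * ennreal (normal_density 0 (sqrt t) y) \<partial>lborel)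
     = ennreal (window_mean \<epsilon> t x)"
  unfolding window_mean_def using \<epsilon>
  by (subst nn_integral_eq_integral[symmetric, OF integrable_window_normal])
    (auto simp: ennreal_mult intro!: nn_integral_cong)

lemma window_mean_le: "0 < t \<Longrightarrow> window_mean \<epsilon> t x \<le> 1 / (2 * \<epsilon>)"
proof -
  assume t: "0 < t"
  have "window_mean \<epsilon> t x \<le> (\<integral>y. 1 / (2 * \<epsilon>) * normal_density 0 (sqrt t) y \<partial>lborel)"
    unfolding window_mean_def using t
    by (intro integral_mono integrable_window_normal integrable_mult_right integrable_normal_density
        mult_right_mono window_le \<epsilon>) auto
  also have "\<dots> = 1 / (2 * \<epsilon>)" using t by simp
  finally show ?thesis .
qed

text \<open>The normal density is at most 1 / sqrt t and the window has total mass 1, so the bound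
  is free of \<epsilon>.\<close>

lemma window_mean_le_inv_sqrt: "0 < t \<Longrightarrow> ennreal (window_mean \<epsilon> t x) \<le> inv_sqrt t"
proof -
  assume t: "0 < t"
  have "ennreal (window_mean \<epsilon> t x)
    = (\<integral>\<^sup>+y. ennreal (window \<epsilon> (x + y)) * ennreal (normal_density 0 (sqrt t) y) \<partial>lborel)"
    using t by (simp add: nn_integral_window_normal)
  also have "\<dots> \<le> (\<integral>\<^sup>+y. ennreal (window \<epsilon> (x + y)) * ennreal (1 / sqrt t) \<partial>lborel)"
    using t by (intro nn_integral_mono mult_left_mono ennreal_leI normal_density_le) auto
  also have "\<dots> = inv_sqrt t"
    using t \<epsilon> by (subst nn_integral_multc)
      (auto simp: nn_integral_window inv_sqrt_def inverse_ennreal inverse_eq_divide)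
  finally show ?thesis .
qed

end

lemma inv_sqrt_pos: "0 < inv_sqrt t"
  by (cases "0 < t") (auto simp: inv_sqrt_def inverse_ennreal ennreal_neg)

lemma inv_sqrt_0: "t \<le> 0 \<Longrightarrow> inv_sqrt t = top"
  by (simp add: inv_sqrt_def ennreal_neg)

lemma measurable_inv_sqrt [measurable]: "inv_sqrt \<in> borel_measurable borel"
  unfolding inv_sqrt_def by measurable

lemma measurable_inv_sqrt_upto [measurable]: "inv_sqrt_upto h \<in> borel_measurable borel"
  unfolding inv_sqrt_upto_def by measurable

lemma inv_sqrt_upto_eq: "0 \<le> t \<Longrightarrow> t \<le> h \<Longrightarrow> inv_sqrt_upto h t = inv_sqrt t"
  by (simp add: inv_sqrt_upto_def)

lemma nn_integral_inv_sqrt_upto: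
  assumes "0 \<le> h"
  shows "(\<integral>\<^sup>+t. inv_sqrt_upto h (t - a) \<partial>lborel) = ennreal (2 * sqrt h)"
proof -
  have "(\<integral>\<^sup>+t. inv_sqrt_upto h (t - a) \<partial>lborel) = (\<integral>\<^sup>+t. inv_sqrt_upto h t \<partial>lborel)"
    by (subst (2) nn_integral_real_affine[of _ 1 "- a"]) (auto simp: algebra_simps)
  also have "\<dots> = (\<integral>\<^sup>+t. ennreal (t powr (- 1 / 2)) * indicator {0..h} t \<partial>lborel)"
  \<comment> \<open>At 0 the left side is infinite while \<open>0 powr (- 1 / 2)\<close> is 0; a
    single point is null.\<close>
  proof (rule nn_integral_cong_AE, use AE_lborel_singleton[of "0::real"] in eventually_elim)
    fix t :: real assume "t \<noteq> 0"
    thus "inv_sqrt_upto h t = ennreal (t powr (- 1 / 2)) * indicator {0..h} t"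
      by (auto simp: inv_sqrt_upto_def inv_sqrt_def indicator_def powr_minus powr_half_sqrt inverse_ennreal)
  qed
  also have "\<dots> = ennreal (h powr (- 1 / 2 + 1) / (- 1 / 2 + 1))"
    using assms by (intro nn_integral_has_integral_lebesgue' has_integral_powr_from_0) auto
  also have "\<dots> = ennreal (2 * sqrt h)" using assms by (simp add: powr_half_sqrt)
  finally show ?thesis .
qed

section \<open>Correlations of centered pairs\<close>

definition near_pair :: "real \<Rightarrow> real \<Rightarrow> real \<Rightarrow> bool" where
  "near_pair h u v \<longleftrightarrow> 0 \<le> u \<and> u < v \<and> v \<le> u + h \<and> v \<le> 1"

text \<open>Bounds the correlation of \<open>centered_pair \<epsilon> h (u, v)\<close> and \<open>centered_pair \<epsilon> h (u', v')\<close> for \<open>u \<le> u'\<close>; it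
  vanishes for \<open>v < u'\<close>. The two summands are the orders \<open>v \<le> v'\<close> and \<open>v' \<le> v\<close>.\<close>

definition overlap_bound :: "real \<Rightarrow> real \<times> real \<Rightarrow> real \<times> real \<Rightarrow> ennreal" where
  "overlap_bound h = (\<lambda>(u, v) (u', v'). inv_sqrt_upto 1 u * inv_sqrt_upto h (u' - u) *
     (inv_sqrt_upto h (v - u') * inv_sqrt_upto h (v' - v) +
      inv_sqrt_upto h (v' - u') * inv_sqrt_upto h (v - v')))"

section \<open>Window expectations by the Markov property, and near-orthogonality of centered
  pairs\<close>

context continuous_markov_motion
begin

context
  fixes \<epsilon> :: real assumes \<epsilon>: "0 < \<epsilon>"
begin

text \<open>Given the position at time \<open>c\<close>, the expected window at time
  \<open>d\<close> is bounded uniformly in that position, so a later window costs just one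
  factor.\<close>

lemma expectation_window_le:
  fixes \<Phi> :: "real \<times> real \<times> real \<Rightarrow> ennreal"
  assumes t: "0 \<le> a" "a \<le> b" "b \<le> c" "c < d" "d \<le> 1"
    and [measurable]: "\<Phi> \<in> borel_measurable borel"
  shows "(\<integral>\<^sup>+\<omega>. \<Phi> (B a \<omega>, B b \<omega>, B c \<omega>) * ennreal (window \<epsilon> (B d \<omega>)) \<partial>M)
    \<le> (\<integral>\<^sup>+\<omega>. \<Phi> (B a \<omega>, B b \<omega>, B c \<omega>) \<partial>M) * inv_sqrt (d - c)"
proof -
  have "(\<integral>\<^sup>+\<omega>. \<Phi> (B a \<omega>, B b \<omega>, B c \<omega>) * ennreal (window \<epsilon> (B d \<omega>)) \<partial>M)
    = (\<integral>\<^sup>+\<omega>. \<Phi> (B a \<omega>, B b \<omega>, B c \<omega>) * ennreal (window_mean \<epsilon> (d - c) (B c \<omega>)) \<partial>M)"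
    using t \<epsilon> by (subst markov_property[of a b c d \<Phi> "\<lambda>x. ennreal (window \<epsilon> x)"])
      (auto simp: nn_integral_window_normal)
  also have "\<dots> \<le> (\<integral>\<^sup>+\<omega>. \<Phi> (B a \<omega>, B b \<omega>, B c \<omega>) * inv_sqrt (d - c) \<partial>M)"
    using t \<epsilon> by (intro nn_integral_mono mult_left_mono window_mean_le_inv_sqrt) auto
  also have "\<dots> = (\<integral>\<^sup>+\<omega>. \<Phi> (B a \<omega>, B b \<omega>, B c \<omega>) \<partial>M) * inv_sqrt (d - c)"
    by (rule nn_integral_multc) (simp add: borel_prod[symmetric])
  finally show ?thesis .
qed

text \<open>The windows are peeled off from the latest to the earliest, each at the cost of the gap
  to its predecessor; the predecessor of the first is time 0.\<close>

lemma four_windows_le: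
  assumes t: "0 \<le> a" "a \<le> b" "b \<le> c" "c \<le> d" "d \<le> 1"
  shows "(\<integral>\<^sup>+\<omega>. ennreal (window \<epsilon> (B a \<omega>) * window \<epsilon> (B b \<omega>) * window \<epsilon> (B c \<omega>) * window \<epsilon> (B d \<omega>)) \<partial>M)
    \<le> inv_sqrt a * inv_sqrt (b - a) * inv_sqrt (c - b) * inv_sqrt (d - c)"
proof (cases "0 < a \<and> a < b \<and> b < c \<and> c < d")
  \<comment> \<open>A vanishing gap makes one factor infinite while all factors are positive, so the
    right-hand side is infinite.\<close>
  case False
  hence "inv_sqrt a * inv_sqrt (b - a) * inv_sqrt (c - b) * inv_sqrt (d - c) = top"
    using t inv_sqrt_pos[of a] inv_sqrt_pos[of "b - a"] inv_sqrt_pos[of "c - b"] inv_sqrt_pos[of "d - c"]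
    by (auto simp: not_less inv_sqrt_0 ennreal_mult_eq_top_iff)
  thus ?thesis by simp
next
  case True
  let ?w = "\<lambda>t \<omega>. ennreal (window \<epsilon> (B t \<omega>))"
  have "(\<integral>\<^sup>+\<omega>. ?w a \<omega> \<partial>M) \<le> inv_sqrt a"
    using expectation_window_le[of 0 0 0 a "\<lambda>_. 1"] True t by (simp add: emeasure_space_1)
  moreover have "(\<integral>\<^sup>+\<omega>. ?w a \<omega> * ?w b \<omega> \<partial>M) \<le> (\<integral>\<^sup>+\<omega>. ?w a \<omega> \<partial>M) * inv_sqrt (b - a)"
    using expectation_window_le[of 0 0 a b "\<lambda>(x, y, z). ennreal (window \<epsilon> z)"] True t
    by (simp add: borel_prod[symmetric])
  moreover have "(\<integral>\<^sup>+\<omega>. ?w a \<omega> * ?w b \<omega> * ?w c \<omega> \<partial>M) \<le> (\<integral>\<^sup>+\<omega>. ?w a \<omega> * ?w b \<omega> \<partial>M) * inv_sqrt (c - b)"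
    using expectation_window_le[of 0 a b c "\<lambda>(x, y, z). ennreal (window \<epsilon> y) * ennreal (window \<epsilon> z)"] True t
    by (simp add: borel_prod[symmetric])
  moreover have "(\<integral>\<^sup>+\<omega>. ?w a \<omega> * ?w b \<omega> * ?w c \<omega> * ?w d \<omega> \<partial>M)
      \<le> (\<integral>\<^sup>+\<omega>. ?w a \<omega> * ?w b \<omega> * ?w c \<omega> \<partial>M) * inv_sqrt (d - c)"
    using expectation_window_le[of a b c d
        "\<lambda>(x, y, z). ennreal (window \<epsilon> x) * ennreal (window \<epsilon> y) * ennreal (window \<epsilon> z)"] True t
    by (simp add: borel_prod[symmetric])
  ultimately have "(\<integral>\<^sup>+\<omega>. ?w a \<omega> * ?w b \<omega> * ?w c \<omega> * ?w d \<omega> \<partial>M)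
      \<le> inv_sqrt a * inv_sqrt (b - a) * inv_sqrt (c - b) * inv_sqrt (d - c)"
    by (meson mult_right_mono order_trans zero_le)
  thus ?thesis using \<epsilon> by (simp add: ennreal_mult)
qed

text \<open>Orthogonality of a martingale difference to functions of the past. With
  \<open>\<Phi>\<close> nonnegative, both expectations can be compared as nonnegative integrals;
  with \<open>\<Phi>\<close> bounded, they are finite and may be subtracted.\<close>

lemma expectation_centered_window:
  fixes \<Phi> :: "real \<times> real \<times> real \<Rightarrow> real"
  assumes t: "0 \<le> a" "a \<le> b" "b \<le> c" "c < d" "d \<le> 1"
    and \<Phi> [measurable]: "\<Phi> \<in> borel_measurable borel" and nonneg: "\<And>z. 0 \<le> \<Phi> z"
    and bound: "\<And>z. \<Phi> z \<le> K"
  shows "(\<integral>\<omega>. \<Phi> (B a \<omega>, B b \<omega>, B c \<omega>) *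
    (window \<epsilon> (B d \<omega>) - window_mean \<epsilon> (d - c) (B c \<omega>)) \<partial>M) = 0"
proof -
  let ?\<Phi> = "\<lambda>\<omega>. \<Phi> (B a \<omega>, B b \<omega>, B c \<omega>)"
  have [measurable]: "?\<Phi> \<in> borel_measurable M" by (simp add: borel_prod[symmetric])
  have K: "0 \<le> K" using order_trans[OF nonneg bound] .
  have i1: "integrable M (\<lambda>\<omega>. ?\<Phi> \<omega> * window \<epsilon> (B d \<omega>))"
    by (rule integrable_const_bound[where B = "K * (1 / (2 * \<epsilon>))"])
      (use \<epsilon> nonneg bound K window_le[OF \<epsilon>] in \<open>auto simp: abs_mult intro!: mult_mono AE_I2
          simp del: times_divide_eq_right\<close>)
  have i2: "integrable M (\<lambda>\<omega>. ?\<Phi> \<omega> * window_mean \<epsilon> (d - c) (B c \<omega>))"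
    by (rule integrable_const_bound[where B = "K * (1 / (2 * \<epsilon>))"])
      (use \<epsilon> nonneg bound K window_mean_le[OF \<epsilon>] t in \<open>auto simp: abs_mult intro!: mult_mono AE_I2
          simp del: times_divide_eq_right\<close>)
  have "ennreal (\<integral>\<omega>. ?\<Phi> \<omega> * window \<epsilon> (B d \<omega>) \<partial>M) = (\<integral>\<^sup>+\<omega>. ennreal (?\<Phi> \<omega>) * ennreal (window \<epsilon> (B d \<omega>)) \<partial>M)"
    using \<epsilon> nonneg by (subst nn_integral_eq_integral[OF i1, symmetric]) (auto simp: ennreal_mult)
  also have "\<dots> = (\<integral>\<^sup>+\<omega>. ennreal (?\<Phi> \<omega>) * ennreal (window_mean \<epsilon> (d - c) (B c \<omega>)) \<partial>M)"
    using t \<epsilon> by (subst markov_property[of a b c d "\<lambda>z. ennreal (\<Phi> z)" "\<lambda>x. ennreal (window \<epsilon> x)"])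
      (auto simp: nn_integral_window_normal)
  also have "\<dots> = ennreal (\<integral>\<omega>. ?\<Phi> \<omega> * window_mean \<epsilon> (d - c) (B c \<omega>) \<partial>M)"
    using \<epsilon> nonneg by (subst nn_integral_eq_integral[OF i2, symmetric]) (auto simp: ennreal_mult)
  finally have "(\<integral>\<omega>. ?\<Phi> \<omega> * window \<epsilon> (B d \<omega>) \<partial>M) = (\<integral>\<omega>. ?\<Phi> \<omega> * window_mean \<epsilon> (d - c) (B c \<omega>) \<partial>M)"
    using \<epsilon> nonneg by (subst (asm) ennreal_inj) (auto intro!: integral_nonneg_AE)
  thus ?thesis using i1 i2 by (simp add: right_diff_distrib)
qed

end

text \<open>A window at time \<open>u\<close> times a martingale difference, hence of conditional
  mean zero given the past up to \<open>u\<close>.\<close>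

definition centered_pair :: "real \<Rightarrow> real \<Rightarrow> real \<times> real \<Rightarrow> 'a \<Rightarrow> real" where
  "centered_pair \<epsilon> h = (\<lambda>(u, v) \<omega>. if near_pair h u v
     then window \<epsilon> (B u \<omega>) * (window \<epsilon> (B v \<omega>) - window_mean \<epsilon> (v - u) (B u \<omega>)) else 0)"

lemma measurable_centered_pair [measurable (raw)]:
  assumes [measurable]: "f \<in> measurable N (borel \<Otimes>\<^sub>M borel)" "g \<in> measurable N M"
  shows "(\<lambda>x. centered_pair \<epsilon> h (f x) (g x)) \<in> borel_measurable N"
  unfolding centered_pair_def near_pair_def split_beta by measurable

text \<open>This bound blows up as \<epsilon> tends to 0; it serves integrability only.\<close>

lemma abs_centered_pair_le:
  assumes \<epsilon>: "0 < \<epsilon>" shows "\<bar>centered_pair \<epsilon> h z \<omega>\<bar> \<le> (1 / (2 * \<epsilon>))\<^sup>2"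
proof -
  obtain u v where z: "z = (u, v)" by (cases z)
  have "\<bar>window \<epsilon> (B u \<omega>)\<bar> * \<bar>window \<epsilon> (B v \<omega>) - window_mean \<epsilon> (v - u) (B u \<omega>)\<bar>
      \<le> (1 / (2 * \<epsilon>)) * (1 / (2 * \<epsilon>))" if "u < v"
  proof (rule mult_mono)
    have "0 \<le> window \<epsilon> (B v \<omega>)" "window \<epsilon> (B v \<omega>) \<le> 1 / (2 * \<epsilon>)"
      "0 \<le> window_mean \<epsilon> (v - u) (B u \<omega>)" "window_mean \<epsilon> (v - u) (B u \<omega>) \<le> 1 / (2 * \<epsilon>)"
      using \<epsilon> that by (auto intro: window_le window_mean_le)
    thus "\<bar>window \<epsilon> (B v \<omega>) - window_mean \<epsilon> (v - u) (B u \<omega>)\<bar> \<le> 1 / (2 * \<epsilon>)" by linarith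
  qed (use \<epsilon> in \<open>auto intro: window_le\<close>)
  thus ?thesis unfolding z centered_pair_def by (auto simp: near_pair_def abs_mult power2_eq_square)
qed

text \<open>The centered factor of the later pair annihilates whatever depends on times up to
  \<open>u'\<close>. What survives is the overlapping case, where the product is dominated by four
  windows in increasing time order.\<close>

lemma expectation_centered_pairs_ordered:
  assumes \<epsilon>: "0 < \<epsilon>" and le: "u \<le> u'"
  shows "ennreal (\<integral>\<omega>. centered_pair \<epsilon> h (u, v) \<omega> * centered_pair \<epsilon> h (u', v') \<omega> \<partial>M)
    \<le> overlap_bound h (u, v) (u', v')"
proof (cases "near_pair h u v \<and> near_pair h u' v'")
  case False
  thus ?thesis by (auto simp: centered_pair_def)
next
  case True
  hence t: "0 \<le> u" "u < v" "v \<le> u + h" "v \<le> 1" "u' < v'" "v' \<le> u' + h" "v' \<le> 1"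
    by (auto simp: near_pair_def)
  let ?w = "\<lambda>t \<omega>. window \<epsilon> (B t \<omega>)" and ?m = "\<lambda>t x. window_mean \<epsilon> t x"
  let ?Z = "\<lambda>\<omega>. ?w v' \<omega> - ?m (v' - u') (B u' \<omega>)"
  define b where "b = 1 / (2 * \<epsilon>)"
  have b: "0 \<le> b" using \<epsilon> by (simp add: b_def)
  have window: "0 \<le> window \<epsilon> x" "window \<epsilon> x \<le> b" for x using \<epsilon> by (auto simp: b_def intro: window_le)
  hence w: "0 \<le> ?w t \<omega>" "?w t \<omega> \<le> b" for t \<omega> by auto
  have m: "0 \<le> ?m (v - u) x" "?m (v - u) x \<le> b" "0 \<le> ?m (v' - u') x" "?m (v' - u') x \<le> b" for x
    using \<epsilon> t by (auto simp: b_def intro: window_mean_le)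
  have Z: "\<bar>?Z \<omega>\<bar> \<le> b" for \<omega> using w[of v' \<omega>] m[of "B u' \<omega>"] by linarith
  have i1: "integrable M (\<lambda>\<omega>. ?w u \<omega> * ?w v \<omega> * ?w u' \<omega> * ?Z \<omega>)"
    by (rule integrable_const_bound[where B = "b * b * b * b"])
      (use w Z b in \<open>auto simp: abs_mult intro!: mult_mono AE_I2\<close>)
  have i2: "integrable M (\<lambda>\<omega>. ?w u \<omega> * ?m (v - u) (B u \<omega>) * ?w u' \<omega> * ?Z \<omega>)"
    by (rule integrable_const_bound[where B = "b * b * b * b"])
      (use w m Z b in \<open>auto simp: abs_mult intro!: mult_mono AE_I2\<close>)
  \<comment> \<open>The compensator of the first pair depends on \<open>B u\<close> alone, so it
    belongs to the past of \<open>u'\<close>.\<close>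
  have "(\<integral>\<omega>. ?w u \<omega> * ?m (v - u) (B u \<omega>) * ?w u' \<omega> * ?Z \<omega> \<partial>M) = 0"
    using expectation_centered_window[OF \<epsilon>, of u u u' v'
        "\<lambda>(x, y, z). window \<epsilon> x * ?m (v - u) x * window \<epsilon> z" "b * b * b"] t le window b m \<epsilon>
    by (simp add: borel_prod[symmetric] split_beta mult_mono)
  hence eq: "(\<integral>\<omega>. centered_pair \<epsilon> h (u, v) \<omega> * centered_pair \<epsilon> h (u', v') \<omega> \<partial>M)
      = (\<integral>\<omega>. ?w u \<omega> * ?w v \<omega> * ?w u' \<omega> * ?Z \<omega> \<partial>M)"
    using Bochner_Integration.integral_diff[OF i1 i2] True
    by (simp add: centered_pair_def algebra_simps)
  show ?thesis
  proof (cases "v \<le> u'")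
    \<comment> \<open>Without overlap \<open>B v\<close> belongs to the past of \<open>u'\<close> as
      well.\<close>
    case True
    have "(\<integral>\<omega>. ?w u \<omega> * ?w v \<omega> * ?w u' \<omega> * ?Z \<omega> \<partial>M) = 0"
      using expectation_centered_window[OF \<epsilon>, of u v u' v'
          "\<lambda>(x, y, z). window \<epsilon> x * window \<epsilon> y * window \<epsilon> z" "b * b * b"] t le window b \<epsilon> True
      by (simp add: borel_prod[symmetric] split_beta mult_mono)
    thus ?thesis by (simp add: eq)
  next
    case False
    have i3: "integrable M (\<lambda>\<omega>. ?w u \<omega> * ?w v \<omega> * ?w u' \<omega> * ?w v' \<omega>)"
      by (rule integrable_const_bound[where B = "b * b * b * b"])
        (use w b \<epsilon> in \<open>auto simp: abs_mult intro!: mult_mono AE_I2\<close>)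
    \<comment> \<open>Dropping the nonnegative mean increases the integrand. A one-sided bound
      suffices because \<open>ennreal\<close> sends negative values to 0.\<close>
    have "(\<integral>\<omega>. ?w u \<omega> * ?w v \<omega> * ?w u' \<omega> * ?Z \<omega> \<partial>M) \<le> (\<integral>\<omega>. ?w u \<omega> * ?w v \<omega> * ?w u' \<omega> * ?w v' \<omega> \<partial>M)"
      using w m by (intro integral_mono i1 i3 mult_left_mono) auto
    hence "ennreal (\<integral>\<omega>. centered_pair \<epsilon> h (u, v) \<omega> * centered_pair \<epsilon> h (u', v') \<omega> \<partial>M)
      \<le> (\<integral>\<^sup>+\<omega>. ennreal (?w u \<omega> * ?w v \<omega> * ?w u' \<omega> * ?w v' \<omega>) \<partial>M)"
      unfolding eq using w by (subst nn_integral_eq_integral[OF i3]) (auto intro: ennreal_leI)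
    also have "\<dots> \<le> overlap_bound h (u, v) (u', v')"
    proof (cases "v \<le> v'")
      case True
      have "(\<integral>\<^sup>+\<omega>. ennreal (?w u \<omega> * ?w v \<omega> * ?w u' \<omega> * ?w v' \<omega>) \<partial>M)
          = (\<integral>\<^sup>+\<omega>. ennreal (?w u \<omega> * ?w u' \<omega> * ?w v \<omega> * ?w v' \<omega>) \<partial>M)" by (simp add: mult_ac)
      also have "\<dots> \<le> inv_sqrt u * inv_sqrt (u' - u) * inv_sqrt (v - u') * inv_sqrt (v' - v)"
        using t le False True by (intro four_windows_le \<epsilon>) auto
      \<comment> \<open>Overlap, \<open>u' < v\<close>, together with \<open>v \<le> u + h\<close>
        and \<open>v' \<le> u' + h\<close> puts all three gaps into [0, h].\<close>
      also have "\<dots> = inv_sqrt_upto 1 u * inv_sqrt_upto h (u' - u) * (inv_sqrt_upto h (v - u') * inv_sqrt_upto h (v' - v))"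
        using t le False True by (simp add: inv_sqrt_upto_eq mult.assoc)
      also have "\<dots> \<le> overlap_bound h (u, v) (u', v')"
        by (auto simp: overlap_bound_def intro!: mult_left_mono)
      finally show ?thesis .
    next
      case v: False
      have "(\<integral>\<^sup>+\<omega>. ennreal (?w u \<omega> * ?w v \<omega> * ?w u' \<omega> * ?w v' \<omega>) \<partial>M)
          = (\<integral>\<^sup>+\<omega>. ennreal (?w u \<omega> * ?w u' \<omega> * ?w v' \<omega> * ?w v \<omega>) \<partial>M)" by (simp add: mult_ac)
      also have "\<dots> \<le> inv_sqrt u * inv_sqrt (u' - u) * inv_sqrt (v' - u') * inv_sqrt (v - v')"
        using t le False v by (intro four_windows_le \<epsilon>) auto
      also have "\<dots> = inv_sqrt_upto 1 u * inv_sqrt_upto h (u' - u) * (inv_sqrt_upto h (v' - u') * inv_sqrt_upto h (v - v'))"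
        using t le False v by (simp add: inv_sqrt_upto_eq mult.assoc)
      also have "\<dots> \<le> overlap_bound h (u, v) (u', v')"
        by (auto simp: overlap_bound_def intro!: mult_left_mono)
      finally show ?thesis .
    qed
    finally show ?thesis .
  qed
qed

lemma expectation_centered_pairs:
  assumes \<epsilon>: "0 < \<epsilon>"
  shows "ennreal (\<integral>\<omega>. centered_pair \<epsilon> h z \<omega> * centered_pair \<epsilon> h z' \<omega> \<partial>M)
    \<le> overlap_bound h z z' + overlap_bound h z' z"
proof (cases "fst z \<le> fst z'")
  case True
  have "ennreal (\<integral>\<omega>. centered_pair \<epsilon> h z \<omega> * centered_pair \<epsilon> h z' \<omega> \<partial>M) \<le> overlap_bound h z z'"
    using expectation_centered_pairs_ordered[OF \<epsilon> True, of h "snd z" "snd z'"] by simp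
  thus ?thesis by (rule order_trans) simp
next
  case False
  have "ennreal (\<integral>\<omega>. centered_pair \<epsilon> h z \<omega> * centered_pair \<epsilon> h z' \<omega> \<partial>M) \<le> overlap_bound h z' z"
    using expectation_centered_pairs_ordered[OF \<epsilon>, of "fst z'" "fst z" h "snd z'" "snd z"] False
    by (simp add: mult.commute)
  thus ?thesis by (rule order_trans) simp
qed

end

section \<open>Second moments\<close>

text \<open>A probability measure on the whole line: bounded measurable functions are integrable,
  and no subspace of times is needed.\<close>

definition unit_lborel :: "real measure" where
  "unit_lborel = density lborel (indicator {0..1})"

lemma sets_unit_lborel [measurable_cong, simp]: "sets unit_lborel = sets borel"
  and space_unit_lborel [simp]: "space unit_lborel = UNIV"
  by (simp_all add: unit_lborel_def)

lemma nn_integral_unit_lborel: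
  "f \<in> borel_measurable borel \<Longrightarrow> (\<integral>\<^sup>+x. f x \<partial>unit_lborel) = (\<integral>\<^sup>+x. f x * indicator {0..1} x \<partial>lborel)"
  unfolding unit_lborel_def by (subst nn_integral_density) (auto simp: mult.commute)

lemma nn_integral_unit_lborel_le:
  assumes [measurable]: "f \<in> borel_measurable borel" and le: "\<And>x. f x \<le> g x"
  shows "(\<integral>\<^sup>+x. f x \<partial>unit_lborel) \<le> (\<integral>\<^sup>+x. g x \<partial>lborel)"
  by (subst nn_integral_unit_lborel) (auto intro!: nn_integral_mono le simp: indicator_def)

interpretation unit_lborel: prob_space unit_lborel
  by standard (simp add: unit_lborel_def emeasure_density)

interpretation unit_square: pair_prob_space unit_lborel unit_lborel ..

interpretation unit_square2: pair_prob_space "unit_lborel \<Otimes>\<^sub>M unit_lborel" "unit_lborel \<Otimes>\<^sub>M unit_lborel" ..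

lemma measurable_overlap_bound [measurable (raw)]:
  assumes [measurable]: "f \<in> borel_measurable N" "g \<in> borel_measurable N"
    "f' \<in> borel_measurable N" "g' \<in> borel_measurable N"
  shows "(\<lambda>x. overlap_bound h (f x, g x) (f' x, g' x)) \<in> borel_measurable N"
  unfolding overlap_bound_def by simp

text \<open>On the whole line the times are integrated out from the latest to the earliest. Each of
  the three kernels cut off at \<open>h\<close> gives 2 * sqrt h, the one at \<open>u\<close> gives
  2, and there are two orders: 2 * 2 * 8 = 32.\<close>

lemma nn_integral_overlap_bound:
  assumes h: "0 \<le> h"
  shows "(\<integral>\<^sup>+w. overlap_bound h (fst w) (snd w)
      \<partial>((unit_lborel \<Otimes>\<^sub>M unit_lborel) \<Otimes>\<^sub>M (unit_lborel \<Otimes>\<^sub>M unit_lborel)))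
    \<le> ennreal (32 * sqrt h ^ 3)"
proof -
  let ?k = "inv_sqrt_upto h" and ?U = unit_lborel
  have k: "(\<integral>\<^sup>+t. ?k (t - a) \<partial>lborel) = ennreal (2 * sqrt h)" for a
    using h by (rule nn_integral_inv_sqrt_upto)
  have inner: "(\<integral>\<^sup>+v. \<integral>\<^sup>+v'. overlap_bound h (u, v) (u', v') \<partial>lborel \<partial>lborel)
      = inv_sqrt_upto 1 u * ?k (u' - u) * ennreal (8 * h)" for u u'
  proof -
    have "(\<integral>\<^sup>+v. \<integral>\<^sup>+v'. ?k (v - u') * ?k (v' - v) \<partial>lborel \<partial>lborel) = ennreal (4 * h)"
      using h by (simp add: nn_integral_cmult nn_integral_multc k flip: ennreal_mult)
    \<comment> \<open>Here \<open>v\<close> is the latest time, so its integral has to be moved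
      inside first.\<close>
    moreover have "(\<integral>\<^sup>+v. \<integral>\<^sup>+v'. ?k (v' - u') * ?k (v - v') \<partial>lborel \<partial>lborel) = ennreal (4 * h)"
      using h by (subst lborel_pair.Fubini')
        (simp_all add: nn_integral_cmult nn_integral_multc k flip: ennreal_mult)
    ultimately show ?thesis using h
      by (simp add: overlap_bound_def nn_integral_cmult nn_integral_add flip: ennreal_plus)
  qed
  have "(\<integral>\<^sup>+w. overlap_bound h (fst w) (snd w) \<partial>((?U \<Otimes>\<^sub>M ?U) \<Otimes>\<^sub>M (?U \<Otimes>\<^sub>M ?U)))
      = (\<integral>\<^sup>+u. \<integral>\<^sup>+v. \<integral>\<^sup>+u'. \<integral>\<^sup>+v'. overlap_bound h (u, v) (u', v') \<partial>?U \<partial>?U \<partial>?U \<partial>?U)"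
  proof -
    have [measurable]: "(\<lambda>w. overlap_bound h (fst w) (snd w)) \<in> borel_measurable ((?U \<Otimes>\<^sub>M ?U) \<Otimes>\<^sub>M (?U \<Otimes>\<^sub>M ?U))"
      using measurable_overlap_bound[of "\<lambda>w. fst (fst w)" "(?U \<Otimes>\<^sub>M ?U) \<Otimes>\<^sub>M (?U \<Otimes>\<^sub>M ?U)"
        "\<lambda>w. snd (fst w)" "\<lambda>w. fst (snd w)" "\<lambda>w. snd (snd w)"] by simp
    have "(\<integral>\<^sup>+u'. \<integral>\<^sup>+v'. overlap_bound h z (u', v') \<partial>?U \<partial>?U) = integral\<^sup>N (?U \<Otimes>\<^sub>M ?U) (overlap_bound h z)" for z
      using measurable_overlap_bound[of "\<lambda>_. fst z" "?U \<Otimes>\<^sub>M ?U" "\<lambda>_. snd z" fst snd]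
      by (intro unit_lborel.nn_integral_fst) simp
    thus ?thesis
      by (simp flip: unit_square.nn_integral_fst unit_lborel.nn_integral_fst)
  qed
  also have "\<dots> \<le> (\<integral>\<^sup>+u. \<integral>\<^sup>+v. \<integral>\<^sup>+u'. \<integral>\<^sup>+v'. overlap_bound h (u, v) (u', v') \<partial>lborel \<partial>lborel \<partial>lborel \<partial>lborel)"
    by (intro nn_integral_unit_lborel_le order_refl) measurable
  \<comment> \<open>The integral over \<open>u'\<close> moves outside that over \<open>v\<close>,
    since \<open>inner\<close> keeps \<open>u\<close> and \<open>u'\<close> fixed.\<close>
  also have "\<dots> = (\<integral>\<^sup>+u. \<integral>\<^sup>+u'. \<integral>\<^sup>+v. \<integral>\<^sup>+v'. overlap_bound h (u, v) (u', v') \<partial>lborel \<partial>lborel \<partial>lborel \<partial>lborel)"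
    by (intro nn_integral_cong lborel_pair.Fubini') measurable
  also have "\<dots> = ennreal (2 * sqrt h) * ennreal 2 * ennreal (8 * h)"
    unfolding inner using nn_integral_inv_sqrt_upto[of 1 0]
    by (simp add: nn_integral_cmult nn_integral_multc k mult_ac)
  also have "\<dots> = ennreal (32 * sqrt h ^ 3)"
    using h by (simp add: power3_eq_cube flip: ennreal_mult ennreal_numeral)
  finally show ?thesis .
qed

section \<open>Variance of the centered part and pathwise splitting of the near-diagonal
  mass\<close>

context continuous_markov_motion
begin

definition centered_mass :: "real \<Rightarrow> real \<Rightarrow> 'a \<Rightarrow> real" where
  "centered_mass \<epsilon> h \<omega> = (\<integral>z. centered_pair \<epsilon> h z \<omega> \<partial>(unit_lborel \<Otimes>\<^sub>M unit_lborel))"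

lemma measurable_centered_mass [measurable]: "centered_mass \<epsilon> h \<in> borel_measurable M"
  unfolding centered_mass_def by measurable

text \<open>The square is a double integral over pairs, and Fubini turns its expectation into an
  integral of correlations; symmetrizing doubles 32. The squared main term is of order h, so the
  centered part gains a factor sqrt h.\<close>

lemma second_moment_centered_mass:
  assumes \<epsilon>: "0 < \<epsilon>" and h: "0 \<le> h"
  shows "(\<integral>\<^sup>+\<omega>. ennreal ((centered_mass \<epsilon> h \<omega>)\<^sup>2) \<partial>M) \<le> ennreal (64 * sqrt h ^ 3)"
proof -
  let ?P = "unit_lborel \<Otimes>\<^sub>M unit_lborel"
  let ?f = "\<lambda>w \<omega>. centered_pair \<epsilon> h (fst w) \<omega> * centered_pair \<epsilon> h (snd w) \<omega>"
  interpret MP: pair_prob_space M "?P \<Otimes>\<^sub>M ?P" ..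
  define c where "c = (1 / (2 * \<epsilon>))\<^sup>2"
  have c: "\<bar>centered_pair \<epsilon> h z \<omega>\<bar> \<le> c" for z \<omega>
    using abs_centered_pair_le[OF \<epsilon>] by (simp add: c_def)
  have cc: "\<bar>?f w \<omega>\<bar> \<le> c * c" for w \<omega>
    unfolding abs_mult by (intro mult_mono c order_trans[OF abs_ge_zero c]) auto
  have int: "integrable (M \<Otimes>\<^sub>M (?P \<Otimes>\<^sub>M ?P)) (\<lambda>(\<omega>, w). ?f w \<omega>)"
    by (rule MP.integrable_const_bound[where B = "c * c"]) (use cc in \<open>auto\<close>)
  have int2: "integrable (?P \<Otimes>\<^sub>M ?P) (\<lambda>(z, z'). centered_pair \<epsilon> h z \<omega> * centered_pair \<epsilon> h z' \<omega>)" 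
    if "\<omega> \<in> space M" for \<omega>
    by (rule unit_square2.integrable_const_bound[where B = "c * c"])
      (use cc[of "(_, _)"] that in \<open>auto simp: split_beta\<close>)
  have sq: "(centered_mass \<epsilon> h \<omega>)\<^sup>2 = (\<integral>w. ?f w \<omega> \<partial>(?P \<Otimes>\<^sub>M ?P))" if "\<omega> \<in> space M" for \<omega>
    using unit_square2.integral_fst[OF int2[OF that]]
    by (simp add: centered_mass_def power2_eq_square case_prod_unfold)
  have "(\<integral>\<^sup>+\<omega>. ennreal ((centered_mass \<epsilon> h \<omega>)\<^sup>2) \<partial>M) = ennreal (\<integral>\<omega>. (centered_mass \<epsilon> h \<omega>)\<^sup>2 \<partial>M)"
  proof (rule nn_integral_eq_integral)
    show "integrable M (\<lambda>\<omega>. (centered_mass \<epsilon> h \<omega>)\<^sup>2)"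
      using MP.integrable_fst[OF int] by (subst Bochner_Integration.integrable_cong[OF refl sq]) auto
  qed auto
  also have "(\<integral>\<omega>. (centered_mass \<epsilon> h \<omega>)\<^sup>2 \<partial>M) = (\<integral>\<omega>. \<integral>w. ?f w \<omega> \<partial>(?P \<Otimes>\<^sub>M ?P) \<partial>M)"
    by (intro Bochner_Integration.integral_cong refl sq)
  also have "\<dots> = (\<integral>w. \<integral>\<omega>. ?f w \<omega> \<partial>M \<partial>(?P \<Otimes>\<^sub>M ?P))"
    by (rule MP.Fubini_integral[OF int, symmetric])
  \<comment> \<open>Correlations may be negative; keeping only their positive parts bounds the
    integral from above.\<close>
  also have "ennreal \<dots> \<le> (\<integral>\<^sup>+w. ennreal (\<integral>\<omega>. ?f w \<omega> \<partial>M) \<partial>(?P \<Otimes>\<^sub>M ?P))"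
  proof -
    have i: "integrable (?P \<Otimes>\<^sub>M ?P) (\<lambda>w. \<integral>\<omega>. ?f w \<omega> \<partial>M)" by (rule MP.integrable_snd[OF int])
    have "(\<integral>w. \<integral>\<omega>. ?f w \<omega> \<partial>M \<partial>(?P \<Otimes>\<^sub>M ?P)) \<le> (\<integral>w. max 0 (\<integral>\<omega>. ?f w \<omega> \<partial>M) \<partial>(?P \<Otimes>\<^sub>M ?P))"
      by (intro integral_mono i integrable_max) auto
    also have "ennreal \<dots> = (\<integral>\<^sup>+w. ennreal (max 0 (\<integral>\<omega>. ?f w \<omega> \<partial>M)) \<partial>(?P \<Otimes>\<^sub>M ?P))"
      by (intro nn_integral_eq_integral[symmetric] i integrable_max) auto
    also have "\<dots> = (\<integral>\<^sup>+w. ennreal (\<integral>\<omega>. ?f w \<omega> \<partial>M) \<partial>(?P \<Otimes>\<^sub>M ?P))"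
      by (intro nn_integral_cong) (simp add: max_def ennreal_neg)
    finally show ?thesis by (simp add: ennreal_leI)
  qed
  also have "\<dots> \<le> (\<integral>\<^sup>+w. overlap_bound h (fst w) (snd w) + overlap_bound h (snd w) (fst w) \<partial>(?P \<Otimes>\<^sub>M ?P))"
    by (intro nn_integral_mono expectation_centered_pairs \<epsilon>)
  also have "\<dots> = (\<integral>\<^sup>+w. overlap_bound h (fst w) (snd w) \<partial>(?P \<Otimes>\<^sub>M ?P)) + (\<integral>\<^sup>+w. overlap_bound h (snd w) (fst w) \<partial>(?P \<Otimes>\<^sub>M ?P))"
    by (intro nn_integral_add) (simp_all add: overlap_bound_def split_beta)
  also have "(\<integral>\<^sup>+w. overlap_bound h (snd w) (fst w) \<partial>(?P \<Otimes>\<^sub>M ?P)) = (\<integral>\<^sup>+w. overlap_bound h (fst w) (snd w) \<partial>(?P \<Otimes>\<^sub>M ?P))"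
    by (subst (2) unit_square2.distr_pair_swap, subst nn_integral_distr) (simp_all add: overlap_bound_def split_beta)
  also have "\<dots> + \<dots> \<le> ennreal (32 * sqrt h ^ 3) + ennreal (32 * sqrt h ^ 3)"
    by (intro add_mono nn_integral_overlap_bound h)
  also have "\<dots> = ennreal (64 * sqrt h ^ 3)" using h by (simp flip: ennreal_plus)
  finally show ?thesis by simp
qed

text \<open>Near-diagonal mass of the occupation measure times itself, with each unordered pair of
  times counted once.\<close>

definition near_mass :: "real \<Rightarrow> real \<Rightarrow> 'a \<Rightarrow> real" where
  "near_mass \<epsilon> h \<omega> = (\<integral>(u, v). (if near_pair h u v then window \<epsilon> (B u \<omega>) * window \<epsilon> (B v \<omega>) else 0)
    \<partial>(unit_lborel \<Otimes>\<^sub>M unit_lborel))"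

text \<open>Each window at \<open>v\<close> splits into its centered part and its conditional mean.
  The mean is at most the inverse root of \<open>v - u\<close>, which integrates over
  \<open>v\<close> to 2 * sqrt h.\<close>

lemma near_mass_le:
  assumes \<epsilon>: "0 < \<epsilon>" and h: "0 \<le> h" and \<omega> [measurable]: "\<omega> \<in> space M"
  shows "near_mass \<epsilon> h \<omega> \<le> \<bar>centered_mass \<epsilon> h \<omega>\<bar> + 2 * sqrt h * (\<integral>u. window \<epsilon> (B u \<omega>) \<partial>unit_lborel)"
proof -
  let ?U = unit_lborel
  define b where "b = 1 / (2 * \<epsilon>)"
  have window: "0 \<le> window \<epsilon> x" "window \<epsilon> x \<le> b" for x using \<epsilon> by (auto simp: b_def intro: window_le)
  have b: "0 \<le> b" using \<epsilon> by (simp add: b_def)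
  define g where "g = (\<lambda>(u, v). if near_pair h u v then window \<epsilon> (B u \<omega>) * window_mean \<epsilon> (v - u) (B u \<omega>) else 0)"
  have g_nonneg: "0 \<le> g z" for z using \<epsilon> by (auto simp: g_def split: prod.split)
  have [measurable]: "g \<in> borel_measurable (?U \<Otimes>\<^sub>M ?U)" unfolding g_def near_pair_def split_beta by measurable
  have "g z \<le> b * b" for z
    using window b window_mean_le[OF \<epsilon>, folded b_def]
    by (auto simp: g_def near_pair_def intro!: mult_mono simp: window_mean_nonneg[OF \<epsilon>] split: prod.split)
  hence i_g: "integrable (?U \<Otimes>\<^sub>M ?U) g"
    by (intro unit_square.integrable_const_bound[where B = "b * b"]) (auto simp: g_nonneg)
  have i_c: "integrable (?U \<Otimes>\<^sub>M ?U) (\<lambda>z. centered_pair \<epsilon> h z \<omega>)"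
    by (rule unit_square.integrable_const_bound[where B = "(1 / (2 * \<epsilon>))\<^sup>2"])
      (use abs_centered_pair_le[OF \<epsilon>] \<omega> in auto)
  have i_w: "integrable ?U (\<lambda>u. window \<epsilon> (B u \<omega>))"
    by (rule unit_lborel.integrable_const_bound[where B = b]) (use window in auto)
  have "near_mass \<epsilon> h \<omega> = (\<integral>z. centered_pair \<epsilon> h z \<omega> + g z \<partial>(?U \<Otimes>\<^sub>M ?U))"
    unfolding near_mass_def
    by (intro Bochner_Integration.integral_cong refl)
      (auto simp: centered_pair_def g_def algebra_simps split: prod.split)
  also have "\<dots> = centered_mass \<epsilon> h \<omega> + (\<integral>z. g z \<partial>(?U \<Otimes>\<^sub>M ?U))"
    unfolding centered_mass_def using i_c i_g by (rule Bochner_Integration.integral_add)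
  also have "(\<integral>z. g z \<partial>(?U \<Otimes>\<^sub>M ?U)) \<le> 2 * sqrt h * (\<integral>u. window \<epsilon> (B u \<omega>) \<partial>?U)"
  proof -
    have "ennreal (\<integral>z. g z \<partial>(?U \<Otimes>\<^sub>M ?U)) = (\<integral>\<^sup>+z. ennreal (g z) \<partial>(?U \<Otimes>\<^sub>M ?U))"
      using i_g g_nonneg by (intro nn_integral_eq_integral[symmetric]) auto
    also have "\<dots> = (\<integral>\<^sup>+u. \<integral>\<^sup>+v. ennreal (g (u, v)) \<partial>?U \<partial>?U)"
      by (subst unit_lborel.nn_integral_fst[symmetric]) auto
    also have "\<dots> \<le> (\<integral>\<^sup>+u. ennreal (window \<epsilon> (B u \<omega>)) * ennreal (2 * sqrt h) \<partial>?U)"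
    proof (rule nn_integral_mono)
      fix u
      have "(\<integral>\<^sup>+v. ennreal (g (u, v)) \<partial>?U) \<le> (\<integral>\<^sup>+v. ennreal (window \<epsilon> (B u \<omega>)) * inv_sqrt_upto h (v - u) \<partial>lborel)"
        by (rule nn_integral_unit_lborel_le)
          (use \<epsilon> in \<open>auto simp: g_def near_pair_def inv_sqrt_upto_eq ennreal_mult intro!: mult_left_mono window_mean_le_inv_sqrt\<close>)
      also have "\<dots> = ennreal (window \<epsilon> (B u \<omega>)) * ennreal (2 * sqrt h)"
        using h by (simp add: nn_integral_cmult nn_integral_inv_sqrt_upto)
      finally show "(\<integral>\<^sup>+v. ennreal (g (u, v)) \<partial>?U) \<le> ennreal (window \<epsilon> (B u \<omega>)) * ennreal (2 * sqrt h)" .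
    qed
    also have "\<dots> = ennreal (\<integral>u. window \<epsilon> (B u \<omega>) \<partial>?U) * ennreal (2 * sqrt h)"
      using i_w window by (subst nn_integral_multc) (auto simp: nn_integral_eq_integral)
    also have "\<dots> = ennreal (2 * sqrt h * (\<integral>u. window \<epsilon> (B u \<omega>) \<partial>?U))"
      using h window by (subst ennreal_mult[symmetric]) (auto intro!: integral_nonneg_AE simp: mult_ac)
    finally show ?thesis using h window by (subst (asm) ennreal_le_iff) (auto intro!: mult_nonneg_nonneg integral_nonneg_AE)
  qed
  finally show ?thesis by linarith
qed

end

section \<open>Almost sure bounds\<close>

lemma four_power: "(4::real) ^ n = (2 ^ n)\<^sup>2"
  by (simp add: power2_eq_square flip: power_mult_distrib)

text \<open>The cells are disjoint, so \<open>u\<close> selects at most one index, and the enlarged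
  cell stays within 2/N of \<open>u\<close>.\<close>

lemma adjacent_indicators_le:
  assumes N: "0 < N"
  shows "(\<Sum>i<N. indicator {real i / N<..(real i + 1) / N} u * indicator {(real i - 1) / N<..(real i + 2) / N} v)
    \<le> (indicator {v. \<bar>u - v\<bar> \<le> 2 / N} v :: ennreal)"
proof -
  let ?I = "\<lambda>i::nat. {real i / N<..(real i + 1) / N}"
  have "?I i \<inter> ?I j = {}" if "i < j" for i j
  proof -
    have "(real i + 1) / N \<le> real j / N" using that by (intro divide_right_mono) auto
    thus ?thesis by auto
  qed
  hence disj: "disjoint_family_on ?I {..<N}" unfolding disjoint_family_on_def
    by (metis Int_commute linorder_neqE_nat)
  have "(\<Sum>i<N. indicator (?I i) u * indicator {(real i - 1) / N<..(real i + 2) / N} v)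
      \<le> (\<Sum>i<N. indicator (?I i) u * (indicator {v. \<bar>u - v\<bar> \<le> 2 / N} v :: ennreal))"
    using N by (intro sum_mono) (auto simp: indicator_def abs_le_iff field_simps)
  also have "\<dots> = indicator (\<Union>i<N. ?I i) u * indicator {v. \<bar>u - v\<bar> \<le> 2 / N} v"
    by (subst indicator_UN_disjoint[OF _ disj]) (auto simp: sum_distrib_right)
  also have "\<dots> \<le> indicator {v. \<bar>u - v\<bar> \<le> 2 / N} v"
    by (auto simp: indicator_def)
  finally show ?thesis .
qed

lemma AE_unit_lborel: "AE s in unit_lborel. s \<in> {0..1}"
  unfolding unit_lborel_def by (subst AE_density) (auto simp: indicator_def)

lemma AE_unit_lborel_neq: "AE s in unit_lborel. s \<noteq> c"
  unfolding unit_lborel_def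
  by (subst AE_density) (use AE_lborel_singleton[of c] in \<open>auto elim: eventually_mono\<close>)

section \<open>Occupation measures along a fixed path and their limit\<close>

context continuous_markov_motion
begin

definition occupation :: "real \<Rightarrow> 'a \<Rightarrow> real \<Rightarrow> real" where
  "occupation \<epsilon> \<omega> t = (\<integral>s. window \<epsilon> (B s \<omega>) * indicator {..t} s \<partial>unit_lborel)"

context
  fixes \<epsilon> :: real and \<omega> :: 'a
  assumes \<epsilon>: "0 < \<epsilon>" and \<omega> [measurable]: "\<omega> \<in> space M"
begin

lemma integrable_window_indicator:
  assumes [measurable]: "A \<in> sets borel"
  shows "integrable unit_lborel (\<lambda>s. window \<epsilon> (B s \<omega>) * indicator A s)"
  by (rule unit_lborel.integrable_const_bound[where B = "1 / (2 * \<epsilon>)"])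
    (use \<epsilon> window_le[OF \<epsilon>] in \<open>auto simp: indicator_def\<close>)

lemma occupation_increment:
  "s \<le> t \<Longrightarrow> ennreal (occupation \<epsilon> \<omega> t - occupation \<epsilon> \<omega> s) =
    (\<integral>\<^sup>+r. ennreal (window \<epsilon> (B r \<omega>)) * indicator {s<..t} r \<partial>unit_lborel)"
proof -
  assume "s \<le> t"
  hence "occupation \<epsilon> \<omega> t - occupation \<epsilon> \<omega> s
      = (\<integral>r. window \<epsilon> (B r \<omega>) * indicator {..t} r - window \<epsilon> (B r \<omega>) * indicator {..s} r \<partial>unit_lborel)"
    unfolding occupation_def by (subst Bochner_Integration.integral_diff) (auto intro: integrable_window_indicator)
  also have "\<dots> = (\<integral>r. window \<epsilon> (B r \<omega>) * indicator {s<..t} r \<partial>unit_lborel)"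
    using \<open>s \<le> t\<close> by (intro Bochner_Integration.integral_cong refl) (auto simp: indicator_def)
  finally show ?thesis using \<epsilon>
    by (simp add: nn_integral_eq_integral[OF integrable_window_indicator, symmetric] ennreal_mult ennreal_indicator)
qed

lemma occupation_mono: "s \<le> t \<Longrightarrow> occupation \<epsilon> \<omega> s \<le> occupation \<epsilon> \<omega> t"
  unfolding occupation_def using \<epsilon>
  by (intro integral_mono integrable_window_indicator) (auto simp: indicator_def)

lemma occupation_1: "occupation \<epsilon> \<omega> 1 = (\<integral>s. window \<epsilon> (B s \<omega>) \<partial>unit_lborel)"
  unfolding occupation_def
  by (intro integral_cong_AE, measurable, use AE_unit_lborel in eventually_elim) auto

lemma occupation_eq:
  "occupation \<epsilon> \<omega> t = measure lborel {s \<in> {0..max 0 (min t 1)}. \<bar>B s \<omega>\<bar> \<le> \<epsilon>} / (2 * \<epsilon>)"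
proof -
  let ?A = "{s \<in> {0..max 0 (min t 1)}. \<bar>B s \<omega>\<bar> \<le> \<epsilon>}"
  have [measurable]: "?A \<in> sets borel" by measurable
  have fin: "emeasure lborel ?A < top"
    by (rule order_le_less_trans[OF emeasure_mono[of _ "{0..1}"]]) auto
  have "ennreal (occupation \<epsilon> \<omega> t) = (\<integral>\<^sup>+s. ennreal (window \<epsilon> (B s \<omega>)) * indicator {..t} s \<partial>unit_lborel)"
    unfolding occupation_def using \<epsilon>
    by (simp add: nn_integral_eq_integral[OF integrable_window_indicator, symmetric] ennreal_mult ennreal_indicator)
  also have "\<dots> = (\<integral>\<^sup>+s. ennreal (window \<epsilon> (B s \<omega>)) * indicator {..t} s * indicator {0..1} s \<partial>lborel)"
    by (rule nn_integral_unit_lborel) measurable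
  \<comment> \<open>For \<open>t < 0\<close> the clamped interval is {0} while \<open>{..t}\<close>
    misses 0, hence equality outside the null point 0.\<close>
  also have "\<dots> = (\<integral>\<^sup>+s. ennreal (1 / (2 * \<epsilon>)) * indicator ?A s \<partial>lborel)"
    by (rule nn_integral_cong_AE, use AE_lborel_singleton[of "0::real"] in eventually_elim)
      (auto simp: window_def indicator_def abs_le_iff max_def min_def)
  also have "\<dots> = ennreal (1 / (2 * \<epsilon>)) * emeasure lborel ?A"
    by (rule nn_integral_cmult_indicator) simp
  also have "\<dots> = ennreal (1 / (2 * \<epsilon>)) * ennreal (measure lborel ?A)"
    using fin by (subst emeasure_eq_ennreal_measure) auto
  also have "\<dots> = ennreal (1 / (2 * \<epsilon>) * measure lborel ?A)"
    using \<epsilon> by (intro ennreal_mult[symmetric]) auto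
  finally show ?thesis using \<epsilon>
    by (subst (asm) ennreal_inj) (auto simp: occupation_def intro!: integral_nonneg_AE)
qed

text \<open>The adjacent sum is a double integral over pairs of times at distance at most 2/N. The
  factor 2 appears because \<open>near_mass\<close> counts only \<open>u < v\<close>.\<close>

lemma adjacent_sum_occupation_le:
  assumes N: "0 < N"
  shows "adjacent_sum (occupation \<epsilon> \<omega>) N \<le> 2 * near_mass \<epsilon> (2 / N) \<omega>"
proof -
  let ?U = unit_lborel and ?w = "\<lambda>s. ennreal (window \<epsilon> (B s \<omega>))"
  let ?I = "\<lambda>i::nat. {real i / N<..(real i + 1) / N}"
  let ?J = "\<lambda>i::nat. {(real i - 1) / N<..(real i + 2) / N}"
  define n where "n = (\<lambda>(u, v). if near_pair (2 / N) u v then window \<epsilon> (B u \<omega>) * window \<epsilon> (B v \<omega>) else 0)"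
  have n_nonneg: "0 \<le> n z" for z using \<epsilon> by (auto simp: n_def split: prod.split)
  have [measurable]: "n \<in> borel_measurable (?U \<Otimes>\<^sub>M ?U)" unfolding n_def near_pair_def split_beta by measurable
  have "n z \<le> 1 / (2 * \<epsilon>) * (1 / (2 * \<epsilon>))" for z
  proof -
    have "window \<epsilon> x * window \<epsilon> y \<le> 1 / (2 * \<epsilon>) * (1 / (2 * \<epsilon>))" for x y
      using \<epsilon> by (intro mult_mono window_le) auto
    thus ?thesis using \<epsilon> by (auto simp: n_def split: prod.split)
  qed
  hence n_int: "integrable (?U \<Otimes>\<^sub>M ?U) n"
    using n_nonneg by (intro unit_square.integrable_const_bound[where B = "1 / (2 * \<epsilon>) * (1 / (2 * \<epsilon>))"]) auto
  have near: "(\<integral>\<^sup>+u. \<integral>\<^sup>+v. ennreal (n (u, v)) \<partial>?U \<partial>?U) = ennreal (near_mass \<epsilon> (2 / N) \<omega>)"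
    unfolding near_mass_def n_def[symmetric]
    using nn_integral_eq_integral[OF n_int] n_nonneg by (simp flip: unit_lborel.nn_integral_fst)
  have near': "(\<integral>\<^sup>+u. \<integral>\<^sup>+v. ennreal (n (v, u)) \<partial>?U \<partial>?U) = ennreal (near_mass \<epsilon> (2 / N) \<omega>)"
    unfolding near[symmetric] by (rule unit_square.Fubini) measurable
  have "ennreal (adjacent_sum (occupation \<epsilon> \<omega>) N) = (\<Sum>i<N. ennreal ((occupation \<epsilon> \<omega> ((real i + 1) / N) - occupation \<epsilon> \<omega> (real i / N)) *
     (occupation \<epsilon> \<omega> ((real i + 2) / N) - occupation \<epsilon> \<omega> ((real i - 1) / N))))"
    unfolding adjacent_sum_def
    by (intro sum_ennreal[symmetric] mult_nonneg_nonneg) (auto intro!: occupation_mono divide_right_mono)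
  also have "\<dots> = (\<Sum>i<N. (\<integral>\<^sup>+u. ?w u * indicator (?I i) u \<partial>?U) * (\<integral>\<^sup>+v. ?w v * indicator (?J i) v \<partial>?U))"
    by (intro sum.cong refl)
      (auto simp: ennreal_mult occupation_mono divide_right_mono simp flip: occupation_increment)
  also have "\<dots> = (\<integral>\<^sup>+u. \<integral>\<^sup>+v. (\<Sum>i<N. (?w u * indicator (?I i) u) * (?w v * indicator (?J i) v)) \<partial>?U \<partial>?U)"
    by (simp add: nn_integral_sum nn_integral_cmult nn_integral_multc)
  also have "\<dots> = (\<integral>\<^sup>+u. \<integral>\<^sup>+v. ?w u * ?w v * (\<Sum>i<N. indicator (?I i) u * indicator (?J i) v) \<partial>?U \<partial>?U)"
    by (simp add: sum_distrib_left mult_ac del: sum_mult_indicator sum_indicator_mult)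
  also have "\<dots> \<le> (\<integral>\<^sup>+u. \<integral>\<^sup>+v. ennreal (n (u, v)) + ennreal (n (v, u)) \<partial>?U \<partial>?U)"
  proof (rule nn_integral_mono_AE, use AE_unit_lborel in eventually_elim, rule nn_integral_mono_AE)
    fix u :: real assume u: "u \<in> {0..1}"
    show "AE v in ?U. ?w u * ?w v * (\<Sum>i<N. indicator (?I i) u * indicator (?J i) v)
        \<le> ennreal (n (u, v)) + ennreal (n (v, u))"
      \<comment> \<open>The diagonal is discarded because \<open>near_pair\<close> is
        strict.\<close>
      using AE_unit_lborel AE_unit_lborel_neq[of u]
    proof eventually_elim
      fix v :: real assume v: "v \<in> {0..1}" "v \<noteq> u"
      have "?w u * ?w v * (\<Sum>i<N. indicator (?I i) u * indicator (?J i) v)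
          \<le> ?w u * ?w v * indicator {v. \<bar>u - v\<bar> \<le> 2 / N} v"
        by (intro mult_left_mono adjacent_indicators_le N) auto
      also have "\<dots> \<le> ennreal (n (u, v)) + ennreal (n (v, u))"
        using u v \<epsilon> by (cases "u < v")
          (auto simp: n_def near_pair_def indicator_def ennreal_mult mult.commute)
      finally show "?w u * ?w v * (\<Sum>i<N. indicator (?I i) u * indicator (?J i) v)
          \<le> ennreal (n (u, v)) + ennreal (n (v, u))" .
    qed
  qed
  also have "\<dots> = ennreal (near_mass \<epsilon> (2 / N) \<omega>) + ennreal (near_mass \<epsilon> (2 / N) \<omega>)"
    by (simp add: nn_integral_add near near')
  also have "\<dots> = ennreal (2 * near_mass \<epsilon> (2 / N) \<omega>)"
    using n_nonneg by (subst ennreal_plus[symmetric])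
      (auto simp: near_mass_def n_def[symmetric] intro!: integral_nonneg_AE)
  finally show ?thesis
    using n_nonneg by (subst (asm) ennreal_le_iff)
      (auto simp: near_mass_def n_def[symmetric] intro!: integral_nonneg_AE)
qed

text \<open>Taking h = 2 / 4^n, the coefficient of the total occupation is 2 * 2 * sqrt (2 /
  4^n).\<close>

lemma adjacent_sum_occupation_le_centered_mass:
  "adjacent_sum (occupation \<epsilon> \<omega>) (4 ^ n)
    \<le> 2 * \<bar>centered_mass \<epsilon> (2 / 4 ^ n) \<omega>\<bar> + 4 * sqrt 2 / 2 ^ n * occupation \<epsilon> \<omega> 1"
proof -
  have "sqrt (2 / 4 ^ n) = sqrt 2 / 2 ^ n" by (simp add: real_sqrt_divide four_power)
  thus ?thesis
    using adjacent_sum_occupation_le[of "4 ^ n"] near_mass_le[OF \<epsilon> _ \<omega>, of "2 / 4 ^ n"]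
    by (simp add: occupation_1)
qed

end

text \<open>A lower limit needs no convergence of the centered masses as \<epsilon> tends to 0;
  Fatou's lemma controls its expectation.\<close>

definition dyadic_error :: "nat \<Rightarrow> 'a \<Rightarrow> ennreal" where
  "dyadic_error n \<omega> = liminf (\<lambda>j. ennreal ((centered_mass (inverse (real (Suc j))) (2 / 4 ^ n) \<omega>)\<^sup>2))"

text \<open>The expected error is at most K / 8^n. The weight 4^n, the inverse square of the target
  scale 2^-n, still leaves a geometric series of ratio 1/2, so the sum has finite expectation and is
  finite almost surely.\<close>

lemma AE_dyadic_error: "AE \<omega> in M. (\<Sum>n. ennreal (4 ^ n) * dyadic_error n \<omega>) < top"
proof -
  have [measurable]: "dyadic_error n \<in> borel_measurable M" for n
    unfolding dyadic_error_def by measurable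
  define K where "K = 64 * sqrt 2 ^ 3"
  have "(\<integral>\<^sup>+\<omega>. dyadic_error n \<omega> \<partial>M) \<le> ennreal (K / 8 ^ n)" for n
  proof -
    have "(\<integral>\<^sup>+\<omega>. dyadic_error n \<omega> \<partial>M)
        \<le> liminf (\<lambda>j. \<integral>\<^sup>+\<omega>. ennreal ((centered_mass (inverse (real (Suc j))) (2 / 4 ^ n) \<omega>)\<^sup>2) \<partial>M)"
      unfolding dyadic_error_def by (rule nn_integral_liminf) measurable
    also have "\<dots> \<le> liminf (\<lambda>j. ennreal (64 * sqrt (2 / 4 ^ n) ^ 3))"
      by (intro Liminf_mono always_eventually allI second_moment_centered_mass) auto
    also have "\<dots> = ennreal (64 * sqrt (2 / 4 ^ n) ^ 3)" by (rule Liminf_const) simp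
    also have "64 * sqrt (2 / 4 ^ n) ^ 3 = K / 8 ^ n"
    proof -
  have "sqrt (2 / 4 ^ n) = sqrt 2 / 2 ^ n" by (simp add: real_sqrt_divide four_power)
      moreover have "(8::real) ^ n = (2 ^ n) ^ 3" by (simp add: power3_eq_cube flip: power_mult_distrib)
      ultimately show ?thesis by (simp add: K_def power_divide)
    qed
    finally show ?thesis .
  qed
  hence "(\<integral>\<^sup>+\<omega>. (\<Sum>n. ennreal (4 ^ n) * dyadic_error n \<omega>) \<partial>M) \<le> (\<Sum>n. ennreal (4 ^ n) * ennreal (K / 8 ^ n))"
    by (subst nn_integral_suminf) (auto simp: nn_integral_cmult intro!: suminf_le mult_left_mono)
  also have "\<dots> = (\<Sum>n. ennreal (K * (1 / 2) ^ n))"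
  proof (rule suminf_cong)
    fix n
    have "(8::real) ^ n = 4 ^ n * 2 ^ n" by (simp flip: power_mult_distrib)
    hence "4 ^ n * (K / 8 ^ n) = K * (1 / 2) ^ n" by (simp add: power_one_over)
    thus "ennreal (4 ^ n) * ennreal (K / 8 ^ n) = ennreal (K * (1 / 2) ^ n)"
      by (subst ennreal_mult[symmetric]) (auto simp: K_def)
  qed
  also have "\<dots> = ennreal (\<Sum>n. K * (1 / 2) ^ n)"
    by (intro suminf_ennreal2 summable_mult summable_geometric) (auto simp: K_def)
  also have "\<dots> < top" by simp
  finally have "(\<integral>\<^sup>+\<omega>. (\<Sum>n. ennreal (4 ^ n) * dyadic_error n \<omega>) \<partial>M) < top" .
  hence "AE \<omega> in M. (\<Sum>n. ennreal (4 ^ n) * dyadic_error n \<omega>) \<noteq> \<infinity>"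
    by (intro nn_integral_PInf_AE) auto
  thus ?thesis by eventually_elim (simp add: less_top)
qed

text \<open>The adjacent sum minus the main term converges along the sequence and is at most twice
  the centered mass. As every weighted error is at most the finite sum \<open>s\<close>, the limit
  is at most 2 * sqrt s / 2^n; the main term contributes the multiple of \<open>G 1\<close>.\<close>

lemma adjacent_sum_limit_le:
  assumes \<omega>: "\<omega> \<in> space M"
    and finite: "(\<Sum>n. ennreal (4 ^ n) * dyadic_error n \<omega>) < top"
    and lim: "\<And>t. (\<lambda>j. occupation (inverse (real (Suc j))) \<omega> t) \<longlonglongrightarrow> G t"
  obtains C where "0 \<le> C" "\<And>n. adjacent_sum G (4 ^ n) \<le> C / 2 ^ n"
proof -
  let ?e = "\<lambda>j. inverse (real (Suc j))"
  obtain s where s: "0 \<le> s" "(\<Sum>n. ennreal (4 ^ n) * dyadic_error n \<omega>) = ennreal s"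
    using finite by (cases "\<Sum>n. ennreal (4 ^ n) * dyadic_error n \<omega>") auto
  have G1: "0 \<le> G 1"
    by (rule LIMSEQ_le_const[OF lim]) (auto simp: occupation_def intro!: integral_nonneg_AE)
  have "adjacent_sum G (4 ^ n) \<le> (2 * sqrt s + 4 * sqrt 2 * G 1) / 2 ^ n" for n
  proof -
    let ?c = "4 * sqrt 2 / 2 ^ n"
    define a where "a j = adjacent_sum (occupation (?e j) \<omega>) (4 ^ n) - ?c * occupation (?e j) \<omega> 1" for j
    define a' where "a' = adjacent_sum G (4 ^ n) - ?c * G 1"
    have lim_a: "a \<longlonglongrightarrow> a'"
      unfolding a_def a'_def adjacent_sum_def by (intro tendsto_intros lim)
    \<comment> \<open>Only an upper bound on \<open>a j\<close> is available, so the positive part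
      is taken before squaring.\<close>
    have "ennreal ((max 0 a' / 2)\<^sup>2) = liminf (\<lambda>j. ennreal ((max 0 (a j) / 2)\<^sup>2))"
      by (intro lim_imp_Liminf[symmetric] tendsto_ennrealI tendsto_intros lim_a) simp_all
    also have "\<dots> \<le> dyadic_error n \<omega>"
      unfolding dyadic_error_def
    proof (intro Liminf_mono always_eventually allI)
      fix j
      have "a j \<le> 2 * \<bar>centered_mass (?e j) (2 / 4 ^ n) \<omega>\<bar>"
        unfolding a_def using adjacent_sum_occupation_le_centered_mass[of "?e j" \<omega> n] \<omega> by simp
      hence "(max 0 (a j) / 2)\<^sup>2 \<le> \<bar>centered_mass (?e j) (2 / 4 ^ n) \<omega>\<bar>\<^sup>2"
        by (intro power_mono) auto
      thus "ennreal ((max 0 (a j) / 2)\<^sup>2) \<le> ennreal ((centered_mass (?e j) (2 / 4 ^ n) \<omega>)\<^sup>2)"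
        by (intro ennreal_leI) simp
    qed
    finally have "ennreal (4 ^ n) * ennreal ((max 0 a' / 2)\<^sup>2) \<le> ennreal (4 ^ n) * dyadic_error n \<omega>"
      by (rule mult_left_mono) simp
    also have "\<dots> \<le> ennreal s"
      unfolding s(2)[symmetric]
      using sum_le_suminf[OF summableI, of "{n}" "\<lambda>n. ennreal (4 ^ n) * dyadic_error n \<omega>"] by simp
    finally have "ennreal (4 ^ n * (max 0 a' / 2)\<^sup>2) \<le> ennreal s"
      by (subst ennreal_mult) auto
    hence "4 ^ n * (max 0 a' / 2)\<^sup>2 \<le> s" using s by (simp add: ennreal_le_iff)
    hence "(2 ^ n * (max 0 a' / 2))\<^sup>2 \<le> (sqrt s)\<^sup>2"
      using s by (simp only: power_mult_distrib four_power real_sqrt_pow2)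
    hence "2 ^ n * (max 0 a' / 2) \<le> sqrt s" by (rule power2_le_imp_le) (use s in auto)
    moreover have "2 ^ n * a' \<le> 2 ^ n * max 0 a'" by (intro mult_left_mono) auto
    ultimately have "2 ^ n * a' \<le> 2 * sqrt s" by linarith
    moreover have "2 ^ n * a' = adjacent_sum G (4 ^ n) * 2 ^ n - 4 * sqrt 2 * G 1"
      by (simp add: a'_def right_diff_distrib)
    ultimately show ?thesis by (simp add: pos_le_divide_eq)
  qed
  thus ?thesis using s G1 by (intro that[of "2 * sqrt s + 4 * sqrt 2 * G 1"]) auto
qed

end

text \<open>The null set is discarded before any kernel is chosen. On a remaining path,
  \<open>C\<close> comes from bounds on the adjacent sums of the local time, and the passage from
  these to the energy is deterministic.\<close>

theorem theorem1p7:
  fixes M :: "'a measure" and B L :: "real \<Rightarrow> 'a \<Rightarrow> real"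
  assumes "brownian_motion M 1 B"
    and "local_time_at_zero M 1 B L"
  shows "AE \<omega> in M. \<exists>C::real. 0 \<le> C \<and>
    (\<forall>f. energy_kernel f \<longrightarrow>
      energy f (distribution_measure 1 (\<lambda>t. L t \<omega>))
        \<le> ennreal C * (\<integral>\<^sup>+ r\<in>{0..1}. f r * ennreal (r powr (- 1 / 2)) \<partial>lborel))"
proof -
  obtain B' where B': "continuous_markov_motion M B'" "AE \<omega> in M. \<forall>t\<in>{0..1}. B' t \<omega> = B t \<omega>"
    using brownian_motion_continuous_version[OF assms(1)] .
  interpret continuous_markov_motion M B' by (rule B'(1))
  have L: "AE \<omega> in M. continuous_on {0..1} (\<lambda>t. L t \<omega>)"
    "AE \<omega> in M. \<forall>t\<in>{0..1}.
      ((\<lambda>\<epsilon>. measure lborel {s \<in> {0..t}. \<bar>B s \<omega>\<bar> \<le> \<epsilon>} / (2 * \<epsilon>)) \<longlongrightarrow> L t \<omega>) (at_right 0)"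
    using assms(2) unfolding local_time_at_zero_def by blast+
  show ?thesis
    using AE_space B'(2) L AE_dyadic_error
  proof eventually_elim
    fix \<omega>
    assume \<omega>: "\<omega> \<in> space M" and B: "\<forall>t\<in>{0..1}. B' t \<omega> = B t \<omega>"
      and cont: "continuous_on {0..1} (\<lambda>t. L t \<omega>)"
      and density: "\<forall>t\<in>{0..1}.
        ((\<lambda>\<epsilon>. measure lborel {s \<in> {0..t}. \<bar>B s \<omega>\<bar> \<le> \<epsilon>} / (2 * \<epsilon>)) \<longlongrightarrow> L t \<omega>) (at_right 0)"
      and finite: "(\<Sum>n. ennreal (4 ^ n) * dyadic_error n \<omega>) < top"
    let ?e = "\<lambda>j. inverse (real (Suc j))"
    define G where "G t = L (max 0 (min t 1)) \<omega>" for t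
    have e: "filterlim ?e (at_right 0) sequentially"
      by (intro tendsto_imp_filterlim_at_right LIMSEQ_inverse_real_of_nat always_eventually) simp
    have lim: "(\<lambda>j. occupation (?e j) \<omega> t) \<longlonglongrightarrow> G t" for t
    proof -
      let ?t = "max 0 (min t 1)"
      have "{s \<in> {0..?t}. \<bar>B' s \<omega>\<bar> \<le> \<epsilon>} = {s \<in> {0..?t}. \<bar>B s \<omega>\<bar> \<le> \<epsilon>}" for \<epsilon> using B by auto
      hence eq: "occupation \<epsilon> \<omega> t = measure lborel {s \<in> {0..?t}. \<bar>B s \<omega>\<bar> \<le> \<epsilon>} / (2 * \<epsilon>)" if "0 < \<epsilon>" for \<epsilon>
        using occupation_eq[OF that \<omega>] by presburger
      have "((\<lambda>\<epsilon>. measure lborel {s \<in> {0..?t}. \<bar>B s \<omega>\<bar> \<le> \<epsilon>} / (2 * \<epsilon>)) \<longlongrightarrow> G t) (at_right 0)"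
        unfolding G_def by (rule density[rule_format]) auto
      hence "(\<lambda>j. measure lborel {s \<in> {0..?t}. \<bar>B s \<omega>\<bar> \<le> ?e j} / (2 * ?e j)) \<longlonglongrightarrow> G t"
        by (rule filterlim_compose[OF _ e])
      moreover have "occupation (?e j) \<omega> t = measure lborel {s \<in> {0..?t}. \<bar>B s \<omega>\<bar> \<le> ?e j} / (2 * ?e j)" for j
        by (rule eq) simp
      ultimately show ?thesis by presburger
    qed
    obtain C where C: "0 \<le> C" "\<And>n. adjacent_sum G (4 ^ n) \<le> C / 2 ^ n"
      using adjacent_sum_limit_le[OF \<omega> finite lim] by blast
    interpret unit_distribution G
    proof
      \<comment> \<open>Monotonicity of the local time is inherited from the occupation functions
        that converge to it.\<close>
      show "G x \<le> G y" if "x \<le> y" for x y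
        by (rule LIMSEQ_le[OF lim lim]) (use that \<omega> in \<open>auto intro!: occupation_mono\<close>)
      show "continuous_on UNIV G"
        unfolding G_def[abs_def]
        by (rule continuous_on_compose2[OF cont]) (auto intro!: continuous_intros)
    qed (auto simp: G_def)
    have "energy f (distribution_measure 1 (\<lambda>t. L t \<omega>))
        \<le> ennreal (8 / 3 * C) * (\<integral>\<^sup>+ r\<in>{0..1}. f r * ennreal (r powr (- 1 / 2)) \<partial>lborel)"
      if "energy_kernel f" for f
    proof -
      have f: "antimono_on {0..} f" using that by (simp add: energy_kernel_def)
      have "distribution_measure 1 (\<lambda>t. L t \<omega>) = interval_measure G"
        by (simp add: distribution_measure_def G_def[abs_def])
      thus ?thesis
        using order_trans[OF energy_le_dyadic_sum[OF f C(2)] dyadic_sum_le_integral[OF f C(1)]] by presburger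
    qed
    thus "\<exists>C::real. 0 \<le> C \<and> (\<forall>f. energy_kernel f \<longrightarrow>
      energy f (distribution_measure 1 (\<lambda>t. L t \<omega>))
        \<le> ennreal C * (\<integral>\<^sup>+ r\<in>{0..1}. f r * ennreal (r powr (- 1 / 2)) \<partial>lborel))"
      using C(1) by (intro exI[of _ "8 / 3 * C"]) simp
  qed
qed

end
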